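(* For every rational number $v\ge1$ (resp. every Perron number $v>1$) and every integer $b\ge2$ there exists a real number $\xi$ whose base-$b$ expansion is an automatic (resp. morphic) infinite word over $\{0,1,\ldots,b-1\}$ and such that $v_b(\xi)=v-1$.
   Context: A Perron number is a positive real algebraic integer that is strictly greater in absolute value than all of its other Galois conjugates. For a real $x$, $\|x\|$ denotes the distance from $x$ to the nearest integer. For a real $\xi$ and integer $b\ge 2$, $v_b(\xi)$ is the supremum of the real numbers $v$ such that $\|b^n\xi\|<(b^n)^{-v}$ has infinitely many solutions in positive integers $n$. The base-$b$ expansion of $\xi$ is the digit sequence $d_1d_2\cdots$ with $d_n\in\{0,\dots,b-1\}$, not ending in $(b-1)^\omega$, with $\xi=\lfloor\xi\rfloor+\sum_{n\ge1}d_nb^{-n}$. Morphic/automatic words: Let $\Sigma$ be a finite alphabet and $\epsilon$ the empty word. A morphism $h:\Sigma^*\to\Sigma^*$ is prolongable on $a\in\Sigma$ if $h(a)=ax$ with $x\in\Sigma^+$ and $h^n(x)\ne\epsilon$ for all $n\ge0$; then $h^n(a)$ converges to the infinite word $h^\omega(a)=a\,x\,h(x)\,h^2(x)\cdots$, called a pure morphic word. A coding is a letter-to-letter morphism. An infinite word is morphic if it is the image under a coding of a pure morphic word, and automatic if it is the image under a coding of a pure morphic word $h^\omega(a)$ with $h$ uniform (all $|h(c)|$ equal). *)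

theory Defs
  imports "HOL-Analysis.Analysis" "HOL-Computational_Algebra.Computational_Algebra"
    "HOL-Library.Extended_Real"
begin

definition is_min_poly :: "rat poly \<Rightarrow> complex \<Rightarrow> bool" where
  "is_min_poly p x \<longleftrightarrow> lead_coeff p = 1 \<and> irreducible p \<and> poly (map_poly of_rat p) x = 0"

definition galois_conjugates :: "complex \<Rightarrow> complex set" where
  "galois_conjugates x = {z. \<exists>p. is_min_poly p x \<and> poly (map_poly of_rat p) z = 0}"

definition perron_number :: "real \<Rightarrow> bool" where
  "perron_number v \<longleftrightarrow> v > 0 \<and> algebraic_int v \<and>
     (\<forall>z \<in> galois_conjugates (complex_of_real v). z \<noteq> complex_of_real v \<longrightarrow> cmod z < v)"

definition dist_int :: "real \<Rightarrow> real" where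
  "dist_int x = \<bar>x - of_int (round x)\<bar>"

definition v_exp :: "nat \<Rightarrow> real \<Rightarrow> ereal" where
  "v_exp b \<xi> = Sup {ereal v | v. infinite {n::nat. n > 0 \<and>
      dist_int (real b ^ n * \<xi>) < (real b ^ n) powr (- v)}}"

text \<open>d 0 d 1 d 2 ... corresponds to the digits d_1 d_2 d_3 ... of the paper.\<close>
definition base_expansion :: "nat \<Rightarrow> real \<Rightarrow> (nat \<Rightarrow> nat) \<Rightarrow> bool" where
  "base_expansion b \<xi> d \<longleftrightarrow> (\<forall>n. d n < b) \<and> \<not> (\<exists>N. \<forall>n\<ge>N. d n = b - 1) \<and>
     (\<lambda>n. real (d n) / real b ^ (n + 1)) sums (\<xi> - of_int \<lfloor>\<xi>\<rfloor>)"

text \<open>Letters are natural numbers; an alphabet is a finite set of them.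
  A morphism is given by its values on letters and extended to words.\<close>
definition morph_ext :: "(nat \<Rightarrow> nat list) \<Rightarrow> nat list \<Rightarrow> nat list" where
  "morph_ext h xs = concat (map h xs)"

definition is_morphism :: "nat set \<Rightarrow> (nat \<Rightarrow> nat list) \<Rightarrow> bool" where
  "is_morphism \<Sigma> h \<longleftrightarrow> (\<forall>c\<in>\<Sigma>. set (h c) \<subseteq> \<Sigma>)"

definition prolongable :: "nat set \<Rightarrow> (nat \<Rightarrow> nat list) \<Rightarrow> nat \<Rightarrow> bool" where
  "prolongable \<Sigma> h a \<longleftrightarrow> a \<in> \<Sigma> \<and> (\<exists>x. set x \<subseteq> \<Sigma> \<and> h a = a # x \<and> x \<noteq> [] \<and>
      (\<forall>n. (morph_ext h ^^ n) x \<noteq> []))"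

text \<open>u is the limit h^omega(a) of the words h^n(a): every h^n(a) is a prefix of u.\<close>
definition is_fixed_word :: "(nat \<Rightarrow> nat list) \<Rightarrow> nat \<Rightarrow> (nat \<Rightarrow> nat) \<Rightarrow> bool" where
  "is_fixed_word h a u \<longleftrightarrow>
     (\<forall>n i. i < length ((morph_ext h ^^ n) [a]) \<longrightarrow> u i = (morph_ext h ^^ n) [a] ! i)"

definition morphic :: "(nat \<Rightarrow> nat) \<Rightarrow> bool" where
  "morphic w \<longleftrightarrow> (\<exists>\<Sigma> h a u \<tau>. finite \<Sigma> \<and> is_morphism \<Sigma> h \<and> prolongable \<Sigma> h a \<and>
      is_fixed_word h a u \<and> w = \<tau> \<circ> u)"

definition automatic :: "(nat \<Rightarrow> nat) \<Rightarrow> bool" where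
  "automatic w \<longleftrightarrow> (\<exists>\<Sigma> h a u \<tau> k. finite \<Sigma> \<and> is_morphism \<Sigma> h \<and> prolongable \<Sigma> h a \<and>
      (\<forall>c\<in>\<Sigma>. length (h c) = k) \<and> is_fixed_word h a u \<and> w = \<tau> \<circ> u)"

end

theory Submission
  imports Defs
begin

text \<open>
  If the nonzero digits of \<open>\<xi>\<close> are ones in isolated positions \<open>n\<^sub>0 < n\<^sub>1 < \<dots>\<close>, then \<open>v_exp b \<xi>\<close> is
  \<open>limsup n\<^sub>j\<^sub>+\<^sub>1 / n\<^sub>j - 1\<close>, so suitable sets of positions have to be realised by morphisms.

  For \<open>v = p / q > 1\<close> take the positions \<open>m * k ^ j\<close> with \<open>m = q\<close> or \<open>p \<le> m < k * q\<close>, where \<open>k > p\<close>: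
  the gap from \<open>q * k ^ j\<close> to \<open>p * k ^ j\<close> has ratio \<open>p / q\<close> and all others are smaller.

  For a Perron number \<open>v\<close> consider the integer sequences satisfying the recurrence of the minimal
  polynomial of \<open>v\<close>, on which the shift acts with dominant eigenvalue \<open>v\<close>. The large ones in
  a cone around the dominant direction are sums of finitely many generators. For large \<open>N\<close> the \<open>N\<close>-fold
  shift of a generator, minus a fixed generator \<open>z\<close>, lies in the cone again, so it decomposes. This gives a
  morphism on the generators under which the length of a word of weight \<open>w\<close> grows like
  \<open>G * w * (v ^ N) ^ n\<close>. Concatenating words of weights \<open>c, c * v, \<dots>, c * v ^ (N - 1)\<close> and their
  iterates, with ones exactly at the starts of these words, makes successive positions grow by the
  factor \<open>v\<close> asymptotically.
\<close>

section \<open>Digits zero and one\<close>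

lemma dist_int_add_int: "dist_int (of_int m + x) = dist_int x"
proof -
  have "round (of_int m + x) = m + round x"
    unfolding round_def by (simp add: add.assoc)
  then show ?thesis by (simp add: dist_int_def)
qed

lemma dist_int_le: "dist_int x \<le> \<bar>x - of_int m\<bar>"
  unfolding dist_int_def by (metis abs_minus_commute round_diff_minimal)

lemma dist_int_ge:
  assumes "c \<le> x" "x \<le> 1 - c"
  shows "c \<le> dist_int x"
proof (cases "round x \<le> 0")
  case True
  then have "real_of_int (round x) \<le> 0" by simp
  then show ?thesis using assms unfolding dist_int_def by linarith
next
  case False
  then have "real_of_int (round x) \<ge> 1" by simp
  then show ?thesis using assms unfolding dist_int_def by linarith
qed

section \<open>Tails of expansions whose digits are zero or one\<close>

locale binary_digits =
  fixes b :: nat and d :: "nat \<Rightarrow> nat"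
  assumes b2: "b \<ge> 2" and d01: "d n \<le> 1"
begin

text \<open>The number to be constructed is \<open>tail 0\<close>; modulo 1, \<open>tail n\<close>
  is \<open>b ^ n * tail 0\<close>, as \<open>tail_mult\<close> shows.\<close>

definition tail :: "nat \<Rightarrow> real" where
  "tail n = (\<Sum>i. real (d (n + i)) / real b ^ (i + 1))"

lemma b_pos: "real b > 0" "real b \<ge> 2" "real b > 1"
  using b2 by auto

lemma geom_sums: "(\<lambda>i. (real b - 1) / real b ^ (i + 1)) sums 1"
proof -
  have "(\<lambda>i. (1 / real b) ^ i) sums (1 / (1 - 1 / real b))"
    by (rule geometric_sums) (use b_pos in auto)
  from sums_mult[OF this, of "(real b - 1) / real b"]
  show ?thesis using b_pos by (simp add: field_simps power_divide)
qed

lemma digit_le: "real (d n) \<le> 1" "real (d n) \<le> real b - 1"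
  using d01[of n] b_pos by linarith+

lemma tail_summable: "summable (\<lambda>i. real (d (n + i)) / real b ^ (i + 1))"
proof (rule summable_comparison_test'[OF sums_summable[OF geom_sums], of 0])
  fix i show "norm (real (d (n + i)) / real b ^ (i + 1)) \<le> (real b - 1) / real b ^ (i + 1)"
    using b_pos digit_le[of "n + i"] by (auto intro!: divide_right_mono)
qed

lemma tail_rec: "tail n = (real (d n) + tail (Suc n)) / real b"
proof -
  have "tail n = real (d n) / real b + (\<Sum>i. real (d (n + Suc i)) / real b ^ (Suc i + 1))"
    unfolding tail_def using suminf_split_head[OF tail_summable[of n]] by simp
  also have "(\<Sum>i. real (d (n + Suc i)) / real b ^ (Suc i + 1))
      = (\<Sum>i. (real (d (Suc n + i)) / real b ^ (i + 1)) / real b)"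
    by (rule suminf_cong) (simp add: field_simps)
  also have "\<dots> = tail (Suc n) / real b"
    unfolding tail_def by (rule suminf_divide[OF tail_summable])
  finally show ?thesis by (simp add: add_divide_distrib)
qed

lemma tail_nonneg: "0 \<le> tail n"
  unfolding tail_def by (rule suminf_nonneg[OF tail_summable]) auto

lemma tail_le_1: "tail n \<le> 1"
proof -
  have "tail n \<le> (\<Sum>i. (real b - 1) / real b ^ (i + 1))"
    unfolding tail_def
    by (rule suminf_le[OF _ tail_summable sums_summable[OF geom_sums]])
       (use b_pos digit_le in \<open>auto intro!: divide_right_mono\<close>)
  then show ?thesis using sums_unique[OF geom_sums] by simp
qed

lemma tail_mult: "\<exists>m::int. real b ^ n * tail 0 = of_int m + tail n"
proof (induction n)
  case 0
  show ?case by (rule exI[of _ 0]) simp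
next
  case (Suc n)
  then obtain m :: int where m: "real b ^ n * tail 0 = of_int m + tail n" by auto
  have "real b ^ Suc n * tail 0 = real b * of_int m + real b * tail n"
    using m by (simp add: algebra_simps)
  also have "real b * tail n = real (d n) + tail (Suc n)"
    using tail_rec[of n] b_pos by (simp add: field_simps)
  finally have "real b ^ Suc n * tail 0 = of_int (int b * m + int (d n)) + tail (Suc n)"
    by simp
  then show ?case by blast
qed

lemma dist_int_tail: "dist_int (real b ^ n * tail 0) = dist_int (tail n)"
proof -
  obtain m :: int where "real b ^ n * tail 0 = of_int m + tail n" using tail_mult by blast
  then show ?thesis by (simp add: dist_int_add_int)
qed

lemma tail_zeros:
  assumes "\<And>s. n \<le> s \<Longrightarrow> s < n + k \<Longrightarrow> d s = 0"
  shows "tail n = tail (n + k) / real b ^ k"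
  using assms
proof (induction k)
  case (Suc k)
  then have "tail n = tail (n + k) / real b ^ k" by simp
  also have "tail (n + k) = tail (n + Suc k) / real b"
    using tail_rec[of "n + k"] Suc.prems[of "n + k"] by simp
  finally show ?case by simp
qed simp

lemma tail_ge:
  assumes "d (n + k) = 1"
  shows "tail n \<ge> 1 / real b ^ (k + 1)"
  using assms
proof (induction k arbitrary: n)
  case 0
  then show ?case using tail_rec[of n] tail_nonneg[of "Suc n"] b_pos by (simp add: field_simps)
next
  case (Suc k)
  have "tail (Suc n) \<ge> 1 / real b ^ (k + 1)" using Suc by simp
  then have "(1 / real b ^ (k + 1)) / real b \<le> (real (d n) + tail (Suc n)) / real b"
    using b_pos by (intro divide_right_mono) auto
  then have "tail n \<ge> (1 / real b ^ (k + 1)) / real b" by (simp only: tail_rec[of n])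
  then show ?case by (simp add: mult_ac)
qed

text \<open>Keeps \<open>tail n\<close> away from 1, so that closeness to an integer can only mean
  closeness to 0. Expanding two digits, the worst cases are 2 / b^2 and 1 / b + 1 / b^2, both at
  most 3/4.\<close>

lemma tail_le:
  assumes "d n = 0 \<or> d (Suc n) = 0"
  shows "tail n \<le> 1 - 1 / real b ^ 2"
proof -
  have r: "tail n = real (d n) / real b + real (d (Suc n)) / real b ^ 2
      + tail (Suc (Suc n)) / real b ^ 2"
    using tail_rec[of n] tail_rec[of "Suc n"] b_pos
    by (simp add: field_simps power2_eq_square)
  have 1: "tail (Suc (Suc n)) / real b ^ 2 \<le> 1 / real b ^ 2"
    using tail_le_1 b_pos by (simp add: divide_right_mono)
  have b4: "1 / real b ^ 2 \<le> 1 / 4"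
    using power_mono[of 2 "real b" 2] b_pos by (intro divide_left_mono) auto
  have bh: "1 / real b \<le> 1 / 2" using b_pos by (simp add: field_simps)
  consider "d n = 0" | "d n = 1" "d (Suc n) = 0"
    using assms d01[of n] by linarith
  then show ?thesis
  proof cases
    case 1
    have "real (d (Suc n)) / real b ^ 2 \<le> 1 / real b ^ 2"
      using digit_le b_pos by (simp add: divide_right_mono)
    then show ?thesis using r 1 \<open>tail (Suc (Suc n)) / real b ^ 2 \<le> 1 / real b ^ 2\<close> b4
      by simp
  next
    case 2
    then show ?thesis using r 1 b4 bh by simp
  qed
qed

text \<open>Since the nonzero digits are isolated, the distance of \<open>b ^ n * \<xi>\<close> to the nearest integer is governed by runs of zeros only.\<close>
lemma expansion_criterion:
  fixes v :: real
  assumes v: "v \<ge> 1"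
    and upper: "\<And>\<epsilon>. \<epsilon> > 0 \<Longrightarrow>
      eventually (\<lambda>n. \<exists>s\<ge>n. real s \<le> (v + \<epsilon>) * real n \<and> d s = 1) sequentially"
    and lower: "\<And>\<epsilon>. \<epsilon> > 0 \<Longrightarrow>
      frequently (\<lambda>n. \<forall>s\<ge>n. real s \<le> (v - \<epsilon>) * real n \<longrightarrow> d s = 0) sequentially"
    and isolated: "eventually (\<lambda>n. d n = 0 \<or> d (Suc n) = 0) sequentially"
  shows "\<exists>\<xi>. base_expansion b \<xi> d \<and> v_exp b \<xi> = ereal (v - 1)"
proof (intro exI conjI)
  obtain M where M: "\<And>n. n \<ge> M \<Longrightarrow> d n = 0 \<or> d (Suc n) = 0"
    using isolated by (auto simp: eventually_sequentially)
  \<comment> \<open>This makes the integer part of \<open>tail 0\<close> equal to 0. Were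
    \<open>tail 0 = 1\<close>, the recursion would force every tail to be 1, against
    \<open>tail_le\<close> at \<open>M\<close>.\<close>
  have "tail 0 < 1"
  proof (rule ccontr)
    assume "\<not> tail 0 < 1"
    then have t0: "tail 0 = 1" using tail_le_1[of 0] by simp
    have "tail n = 1" for n
    proof (induction n)
      case (Suc n)
      then have "real (d n) + tail (Suc n) = real b"
        using tail_rec[of n] b_pos by (simp add: field_simps)
      then show ?case using tail_le_1[of "Suc n"] digit_le[of n] b_pos by linarith
    qed (use t0 in simp)
    then have "1 \<le> 1 - 1 / real b ^ 2" using tail_le[OF M[OF order_refl]] by metis
    then show False using b_pos by simp
  qed
  then have fl: "\<lfloor>tail 0\<rfloor> = 0" using tail_nonneg[of 0] by (simp add: floor_eq_iff)
  show "base_expansion b (tail 0) d"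
    unfolding base_expansion_def
  proof (intro conjI)
    show "\<forall>n. d n < b" using d01 b2 by (meson le_trans less_le_trans not_less one_less_numeral_iff order_less_le_trans semiring_norm(76))
    show "\<not> (\<exists>N. \<forall>n\<ge>N. d n = b - 1)"
    proof
      assume "\<exists>N. \<forall>n\<ge>N. d n = b - 1"
      then obtain N where "\<And>n. n \<ge> N \<Longrightarrow> d n = b - 1" by blast
      then have "d (max M N) = b - 1" "d (Suc (max M N)) = b - 1" by simp_all
      then show False using M[of "max M N"] b2 by simp
    qed
    show "(\<lambda>n. real (d n) / real b ^ (n + 1)) sums (tail 0 - of_int \<lfloor>tail 0\<rfloor>)"
      unfolding fl using summable_sums[OF tail_summable[of 0]] by (simp add: tail_def)
  qed
  define A where "A v' = {n::nat. n > 0 \<and>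
      dist_int (real b ^ n * tail 0) < (real b ^ n) powr (- v')}" for v'
  have pw: "(real b ^ n) powr (- v') = real b powr (- (v' * real n))" for n v'
    using b_pos by (simp add: powr_realpow[symmetric] powr_powr mult.commute)
  \<comment> \<open>If v' exceeds v - 1, the next one after a large n comes early enough to make
    \<open>tail n\<close> at least b^(-v' n), and \<open>tail_le\<close> keeps it equally far from
    1. Hence \<open>A v'\<close> is finite.\<close>
  have ge: "v' \<le> v - 1" if inf: "infinite (A v')" for v'
  proof (rule ccontr)
    assume "\<not> v' \<le> v - 1"
    then have v': "v' > v - 1" by simp
    define e where "e = (v' - (v - 1)) / 2"
    have e: "e > 0" "v' = v - 1 + 2 * e" using v' by (auto simp: e_def field_simps)
    obtain K where K: "\<And>n. n \<ge> K \<Longrightarrow> \<exists>s\<ge>n. real s \<le> (v + e) * real n \<and> d s = 1"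
      using upper[OF e(1)] by (auto simp: eventually_sequentially)
    \<comment> \<open>The bound 2 / e yields e * n \<ge> 2, which absorbs the extra 1 in the
      exponent \<open>s - n + 1\<close> and gives v' * n \<ge> 2 for the comparison with 1 /
      b^2.\<close>
    define L where "L = max (max K M) (nat \<lceil>2 / e\<rceil>)"
    have "A v' \<subseteq> {..<L}"
    proof
      fix n assume n: "n \<in> A v'"
      show "n \<in> {..<L}"
      proof (rule ccontr)
        assume "n \<notin> {..<L}"
        then have Ln: "L \<le> n" by simp
        have nL: "n \<ge> K" "n \<ge> M" "n \<ge> nat \<lceil>2 / e\<rceil>"
          using Ln unfolding L_def by linarith+
        have nL': "real n \<ge> 2 / e"
          using nL(3) real_nat_ceiling_ge[of "2 / e"] by (meson of_nat_le_iff order_trans)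
        have en: "e * real n \<ge> 2" using e nL' by (simp add: field_simps)
        have vn: "v' * real n \<ge> 2 * e * real n" using e v by (simp add: mult_right_mono)
        obtain s where s: "s \<ge> n" "real s \<le> (v + e) * real n" "d s = 1" using K nL by blast
        have "1 / real b ^ (s - n + 1) \<le> tail n"
          using tail_ge[of n "s - n"] s by simp
        moreover have "real b powr (- (v' * real n)) \<le> 1 / real b ^ (s - n + 1)"
        proof -
          have "real (s - n + 1) \<le> v' * real n"
            using s en by (simp add: e(2) algebra_simps of_nat_diff)
          then have "real b powr (- (v' * real n)) \<le> real b powr (- real (s - n + 1))"
            using b_pos by (intro powr_mono) auto
          also have "\<dots> = 1 / real b ^ (s - n + 1)"
            using b_pos by (simp only: powr_minus powr_realpow) (simp add: divide_simps)
          finally show ?thesis .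
        qed
        moreover have "tail n \<le> 1 - real b powr (- (v' * real n))"
        proof -
          have "real b powr (- (v' * real n)) \<le> real b powr (- real 2)"
            using b_pos vn en by (intro powr_mono) auto
          also have "\<dots> = 1 / real b ^ 2"
            using b_pos by (simp only: powr_minus powr_realpow) (simp add: divide_simps)
          finally show ?thesis using tail_le[OF M[OF nL(2)]] by linarith
        qed
        ultimately have "real b powr (- (v' * real n)) \<le> dist_int (tail n)"
          by (intro dist_int_ge) auto
        then show False using n by (simp add: A_def pw dist_int_tail)
      qed
    qed
    then show False using inf finite_subset by blast
  qed
  have le: "infinite (A v')" if v': "v' < v - 1" for v'
  proof -
    define e where "e = (v - 1 - v') / 2"
    have e: "e > 0" "v' = v - 1 - 2 * e" using v' by (auto simp: e_def field_simps)
    have "\<exists>n>k. n \<in> A v'" for k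
    proof -
      have "eventually (\<lambda>n. n > max k 0) sequentially" by (rule eventually_gt_at_top)
      then have "frequently (\<lambda>n. (\<forall>s\<ge>n. real s \<le> (v - e) * real n \<longrightarrow> d s = 0) \<and> n > max k 0) sequentially"
        using frequently_eventually_frequently[OF lower[OF e(1)]] by blast
      then obtain n where n: "\<And>s. s \<ge> n \<Longrightarrow> real s \<le> (v - e) * real n \<Longrightarrow> d s = 0" "n > k" "n > 0"
        by (auto dest!: frequently_ex)
      \<comment> \<open>A length of a run of zeros that is guaranteed to start at \<open>n\<close>;
        since \<open>v' = v - 1 - 2 * e\<close>, it exceeds \<open>v' * n\<close>.\<close>
      define j where "j = nat \<lceil>(v - 1 - e) * real n\<rceil>"
      have "(v' + e) * real n \<le> real j" by (simp add: j_def e(2) algebra_simps) linarith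
      moreover have "e * real n > 0" using e n by simp
      ultimately have j: "v' * real n < real j" by (simp add: algebra_simps)
      have "tail n = tail (n + j) / real b ^ j"
      proof (rule tail_zeros)
        fix s assume s: "n \<le> s" "s < n + j"
        then have "int (s - n) < \<lceil>(v - 1 - e) * real n\<rceil>" unfolding j_def by linarith
        then have "real (s - n) < (v - 1 - e) * real n" by (simp add: less_ceiling_iff)
        then show "d s = 0" using s by (intro n(1)) (auto simp: of_nat_diff algebra_simps)
      qed
      also have "\<dots> \<le> 1 / real b ^ j" using tail_le_1 b_pos by (simp add: divide_right_mono)
      also have "\<dots> = real b powr (- real j)"
        using b_pos by (simp only: powr_minus powr_realpow) (simp add: divide_simps)
      also have "\<dots> < real b powr (- (v' * real n))"
        using b_pos j by (intro powr_less_mono) auto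
      finally have "dist_int (tail n) < real b powr (- (v' * real n))"
        using dist_int_le[of "tail n" 0] tail_nonneg[of n] by simp
      then show ?thesis using n by (auto simp: A_def pw dist_int_tail)
    qed
    then show ?thesis by (simp add: infinite_nat_iff_unbounded)
  qed
  show "v_exp b (tail 0) = ereal (v - 1)"
    unfolding v_exp_def A_def[symmetric]
  proof (rule antisym)
    show "Sup {ereal v' |v'. infinite (A v')} \<le> ereal (v - 1)"
      by (rule Sup_least) (auto dest: ge)
    show "ereal (v - 1) \<le> Sup {ereal v' |v'. infinite (A v')}"
    proof (rule ereal_le_epsilon2)
      fix e :: real assume "e > 0"
      then have "ereal (v - 1 - e) \<le> Sup {ereal v' |v'. infinite (A v')}"
        using le[of "v - 1 - e"] by (intro Sup_upper) auto
      then have "ereal (v - 1 - e) + ereal e \<le> Sup {ereal v' |v'. infinite (A v')} + ereal e"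
        by (rule add_right_mono)
      then show "ereal (v - 1) \<le> Sup {ereal v' |v'. infinite (A v')} + ereal e" by simp
    qed
  qed
qed

end

section \<open>Rational exponents\<close>

lemma morph_ext_append: "morph_ext h (xs @ ys) = morph_ext h xs @ morph_ext h ys"
  by (simp add: morph_ext_def)

lemma morph_ext_funpow_append:
  "(morph_ext h ^^ n) (xs @ ys) = (morph_ext h ^^ n) xs @ (morph_ext h ^^ n) ys"
  by (induction n) (simp_all add: morph_ext_append)

lemma morph_ext_funpow_concat:
  "(morph_ext h ^^ n) (concat xss) = concat (map (morph_ext h ^^ n) xss)"
proof (induction xss)
  case Nil
  have "(morph_ext h ^^ n) [] = []" by (induction n) (simp_all add: morph_ext_def)
  then show ?case by simp
qed (simp add: morph_ext_funpow_append)

lemma set_morph_ext_funpow: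
  assumes "is_morphism \<Sigma> h" "set w \<subseteq> \<Sigma>"
  shows "set ((morph_ext h ^^ n) w) \<subseteq> \<Sigma>"
proof (induction n)
  case (Suc n)
  then show ?case using assms(1) by (fastforce simp: morph_ext_def is_morphism_def)
qed (use assms in simp)

lemma length_morph_ext_uniform:
  assumes "\<forall>c\<in>\<Sigma>. length (h c) = k" "set w \<subseteq> \<Sigma>"
  shows "length (morph_ext h w) = k * length w"
  using assms(2) by (induction w) (use assms(1) in \<open>auto simp: morph_ext_def\<close>)

lemma nth_morph_ext_uniform:
  assumes "\<forall>c\<in>\<Sigma>. length (h c) = k" "set w \<subseteq> \<Sigma>" "i < length w" "r < k"
  shows "morph_ext h w ! (k * i + r) = h (w ! i) ! r"
  using assms(2,3)
proof (induction w arbitrary: i)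
  case (Cons c w)
  have len: "length (h c) = k" using Cons.prems assms(1) by simp
  show ?case
  proof (cases i)
    case 0
    then show ?thesis using len assms(4) by (simp add: morph_ext_def nth_append)
  next
    case (Suc j)
    then have "morph_ext h w ! (k * j + r) = h (w ! j) ! r" using Cons by simp
    moreover have "morph_ext h (c # w) ! (k * i + r) = morph_ext h w ! (k * j + r)"
      using len Suc by (simp add: morph_ext_def nth_append)
    ultimately show ?thesis using Suc by simp
  qed
qed simp

text \<open>For a uniform morphism the fixed word is characterised locally: letter \<open>i\<close>
  of an iterate comes from letter \<open>i div k\<close> of the previous one. The instance n = r = 0
  shows that \<open>h (u 0)\<close> begins with \<open>u 0\<close>.\<close>

lemma automaticI:
  assumes fin: "finite \<Sigma>" and mor: "is_morphism \<Sigma> h" and k: "k \<ge> 2"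
    and len: "\<forall>c\<in>\<Sigma>. length (h c) = k" and a: "u 0 \<in> \<Sigma>"
    and u: "\<And>n r. r < k \<Longrightarrow> u (k * n + r) = h (u n) ! r"
  shows "automatic (\<tau> \<circ> u)"
proof -
  define W where "W n = (morph_ext h ^^ n) [u 0]" for n
  have setW: "set (W n) \<subseteq> \<Sigma>" for n
    unfolding W_def by (rule set_morph_ext_funpow[OF mor]) (use a in simp)
  have fixw: "is_fixed_word h (u 0) u"
    unfolding is_fixed_word_def W_def[symmetric]
  proof (intro allI impI)
    fix n i assume "i < length (W n)"
    then show "u i = W n ! i"
    proof (induction n arbitrary: i)
      case 0
      then show ?case by (simp add: W_def)
    next
      case (Suc n)
      have WS: "W (Suc n) = morph_ext h (W n)" by (simp add: W_def)
      have r: "i mod k < k" using k by simp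
      have "i div k < length (W n)"
        using Suc.prems k length_morph_ext_uniform[OF len setW, of n]
        by (simp add: WS less_mult_imp_div_less mult.commute)
      then have "u (i div k) = W n ! (i div k)"
        and "morph_ext h (W n) ! (k * (i div k) + i mod k) = h (W n ! (i div k)) ! (i mod k)"
        using nth_morph_ext_uniform[OF len setW _ r] by (blast intro: Suc.IH)+
      then show ?case using u[OF r, of "i div k"] by (simp add: WS)
    qed
  qed
  obtain x where x: "h (u 0) = u 0 # x"
  proof -
    have "h (u 0) \<noteq> []" "h (u 0) ! 0 = u 0" using len a k u[of 0 0] by auto
    then show ?thesis using that by (cases "h (u 0)") auto
  qed
  have "set (h (u 0)) \<subseteq> \<Sigma>" using mor a by (simp add: is_morphism_def)
  then have sx: "set x \<subseteq> \<Sigma>" using x by simp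
  have lx: "length x \<ge> 1" using len a x k by fastforce
  have "length ((morph_ext h ^^ n) x) \<ge> 1" for n
  proof (induction n)
    case (Suc n)
    have "length (morph_ext h ((morph_ext h ^^ n) x)) = k * length ((morph_ext h ^^ n) x)"
      by (rule length_morph_ext_uniform[OF len set_morph_ext_funpow[OF mor sx]])
    then show ?case using Suc k by simp
  qed (use lx in simp)
  then have "\<forall>n. (morph_ext h ^^ n) x \<noteq> []" by (metis list.size(3) not_one_le_zero)
  then have "prolongable \<Sigma> h (u 0)"
    unfolding prolongable_def using a x sx lx by auto
  then show ?thesis unfolding automatic_def using fin mor len fixw by blast
qed

text \<open>Beyond \<open>k * q\<close> the set \<open>S\<close> of positions contains precisely k
  times its own elements. This self-similarity makes its indicator word automatic, and its largest
  relative gap is p / q.\<close>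

lemma rational_exponent_gt_1:
  fixes b p q :: nat
  assumes b: "b \<ge> 2" and q: "q \<ge> 1" and pq: "q < p"
  shows "\<exists>\<xi> d. base_expansion b \<xi> d \<and> automatic d \<and> v_exp b \<xi> = ereal (real p / real q - 1)"
proof -
  \<comment> \<open>Because of \<open>k > p\<close>, the gap from \<open>q * k ^ j\<close> to
    \<open>p * k ^ j\<close> ends before the next scale \<open>q * k ^ Suc j\<close>.\<close>
  define k where "k = p + 1"
  have k: "k \<ge> 2" "p < k" "p < k * q"
    using pq q by (auto simp: k_def add_strict_increasing intro: less_le_trans[of p "(p+1)*1"])
  define M where "M = {m. m = q \<or> (p \<le> m \<and> m < k * q)}"
  define S where "S = {m * k ^ j | m j. m \<in> M}"
  have Mq: "m \<ge> q" "m < k * q" if "m \<in> M" for m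
    using that pq k q by (auto simp: M_def)
  \<comment> \<open>All multipliers in \<open>M\<close> are below \<open>k * q\<close>, so an
    element of \<open>S\<close> that is at least \<open>k * q\<close> carries a positive power of k,
    from which one factor k can be removed.\<close>
  have S_step: "k * n + r \<in> S \<longleftrightarrow> r = 0 \<and> n \<in> S" if n: "n \<ge> q" and r: "r < k" for n r
  proof
    assume "k * n + r \<in> S"
    then obtain m j where mj: "k * n + r = m * k ^ j" "m \<in> M" by (auto simp: S_def)
    have "j \<noteq> 0"
    proof
      assume "j = 0"
      then have "k * n + r < k * q" using mj Mq by simp
      moreover have "k * q \<le> k * n" using n by simp
      ultimately show False by linarith
    qed
    then obtain i where i: "j = Suc i" by (cases j) auto
    have e: "k * n + r = k * (m * k ^ i)" using mj i by simp
    have "(k * n + r) mod k = 0" unfolding e by simp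
    then have "r = 0" using r by simp
    then have "n = m * k ^ i" using e k by simp
    then show "r = 0 \<and> n \<in> S" using \<open>r = 0\<close> mj by (auto simp: S_def)
  next
    assume "r = 0 \<and> n \<in> S"
    then obtain m j where mj: "n = m * k ^ j" "m \<in> M" "r = 0" by (auto simp: S_def)
    then have "k * n + r = m * k ^ Suc j" by simp
    then show "k * n + r \<in> S" using mj unfolding S_def by blast
  qed
  \<comment> \<open>Letters 1 and 0 record membership in \<open>S\<close>. The positions below
    \<open>q\<close>, to which \<open>S_step\<close> does not apply, get individual letters, so that
    \<open>h\<close> can list their blocks explicitly; the coding sends these letters to 0.\<close>
  define u where "u n = (if n < q then n + 2 else if n \<in> S then 1 else 0 :: nat)" for n
  define h where "h c = (if c \<ge> 2 then map u [k * (c - 2)..<k * (c - 2) + k]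
     else c # replicate (k - 1) 0)" for c
  define \<tau> where "\<tau> c = (if c = 1 then 1 else 0 :: nat)" for c :: nat
  define d where "d = \<tau> \<circ> u"
  have u_lt: "u n < q + 2" for n by (auto simp: u_def)
  have "automatic d"
    unfolding d_def
  proof (rule automaticI)
    show "finite {..<q + 2}" by simp
    show "is_morphism {..<q + 2} h"
      using u_lt by (auto simp: is_morphism_def h_def split: if_splits)
    show "\<forall>c\<in>{..<q + 2}. length (h c) = k" using k by (auto simp: h_def)
    show "u 0 \<in> {..<q + 2}" using u_lt by simp
    show "u (k * n + r) = h (u n) ! r" if r: "r < k" for n r
    proof (cases "n < q")
      case True
      then show ?thesis using r by (simp add: u_def[of n] h_def)
    next
      case False
      have "k * n + r \<ge> q" using False k by (simp add: trans_le_add1 order.trans[of q n])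
      then have "u (k * n + r) = (if r = 0 \<and> n \<in> S then 1 else 0)"
        using S_step[OF _ r, of n] False by (simp add: u_def)
      moreover have "h (u n) ! r = (if r = 0 \<and> n \<in> S then 1 else 0)"
        using False r by (cases r) (auto simp: u_def h_def)
      ultimately show ?thesis by simp
    qed
  qed (use k in simp)
  have d_eq: "d n = (if n \<ge> q \<and> n \<in> S then 1 else 0)" for n
    by (auto simp: d_def \<tau>_def u_def)
  have S_ge: "n \<ge> q" if n: "n \<in> S" for n
  proof -
    obtain m j where "n = m * k ^ j" "m \<in> M" using n by (auto simp: S_def)
    moreover have "k ^ j \<ge> 1" using k by simp
    ultimately show ?thesis using Mq(1)[of m] by (metis le_trans mult.right_neutral mult_le_mono2)
  qed
  have d_S: "d n = (if n \<in> S then 1 else 0)" for n using S_ge by (auto simp: d_eq)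
  define v where "v = real p / real q"
  have v1: "v > 1" using pq q by (simp add: v_def)
  \<comment> \<open>Let n lie between m * k^j and (m + 1) * k^j with q \<le> m < k * q. If m < p,
    the element \<open>p * k ^ j\<close> is at most v times q * k^j \<le> n. Otherwise the next
    multiplier m + 1 works, since (m + 1) / m \<le> p / q for m \<ge> p > q.\<close>
  have next_S: "\<exists>s\<ge>n. real s \<le> v * real n \<and> s \<in> S" if n: "n \<ge> q" for n
  proof -
    obtain j where j: "q * k ^ j \<le> n" "n < q * k ^ Suc j"
    proof -
      have ex: "n < q * k ^ Suc n"
      proof -
        have "n < 2 ^ n" by (rule less_exp)
        also have "(2::nat) ^ n \<le> k ^ n" using k by (intro power_mono) auto
        also have "\<dots> \<le> q * k ^ Suc n" using k q by simp
        finally show ?thesis .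
      qed
      define j where "j = (LEAST j. n < q * k ^ Suc j)"
      have "n < q * k ^ Suc j" unfolding j_def using ex by (rule LeastI)
      moreover have "q * k ^ j \<le> n"
      proof (cases j)
        case (Suc i)
        then have "\<not> n < q * k ^ Suc i" using not_less_Least[of i "\<lambda>j. n < q * k ^ Suc j"] j_def by simp
        then show ?thesis using Suc by simp
      qed (use n in simp)
      ultimately show ?thesis using that by blast
    qed
    have kj: "k ^ j \<ge> 1" using k by simp
    define m where "m = n div k ^ j"
    have "m < q * k"
      unfolding m_def using j by (intro less_mult_imp_div_less) (simp add: mult_ac)
    have "q \<le> m" unfolding m_def using div_le_mono[OF j(1), of "k ^ j"] k by simp
    have n1: "n < (m + 1) * k ^ j" unfolding m_def
      using kj by (metis add.commute dividend_less_times_div less_le_trans mult.commute mult_Suc_right plus_1_eq_Suc zero_less_one order_less_le_trans)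
    have n2: "m * k ^ j \<le> n" unfolding m_def by simp
    show ?thesis
    proof (cases "m < p")
      case True
      have "p * k ^ j \<in> S" using k unfolding S_def M_def by auto
      moreover have "n \<le> p * k ^ j"
        using n1 True mult_le_mono1[of "m + 1" p "k ^ j"] by linarith
      moreover have "real (p * k ^ j) \<le> v * real n"
      proof -
        have "real (p * k ^ j) = v * real (q * k ^ j)" using q by (simp add: v_def)
        also have "\<dots> \<le> v * real n" using of_nat_mono[OF j(1)] v1 by (intro mult_left_mono) auto
        finally show ?thesis .
      qed
      ultimately show ?thesis by blast
    next
      case False
      have "(m + 1) * k ^ j \<in> S"
      proof (cases "m + 1 = q * k")
        case True
        then have "(m + 1) * k ^ j = q * k ^ Suc j" by (simp add: mult_ac)
        then show ?thesis unfolding S_def M_def by blast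
      next
        case False': False
        then have "m + 1 \<in> M" using \<open>m < q * k\<close> False by (auto simp: M_def mult.commute)
        then show ?thesis unfolding S_def by blast
      qed
      moreover have "real ((m + 1) * k ^ j) \<le> v * real n"
      proof -
        have "q * (m + 1) \<le> p * m"
        proof -
          have "q * (m + 1) \<le> q * m + m" using False pq by simp
          also have "\<dots> \<le> p * m" using pq mult_le_mono1[of "q + 1" p m] by simp
          finally show ?thesis .
        qed
        then have "real (q * (m + 1)) \<le> real (p * m)" by (rule of_nat_mono)
        then have "real q * real (m + 1) \<le> real p * real m" by (simp only: of_nat_mult)
        then have "real (m + 1) \<le> v * real m"
          using q by (simp add: v_def pos_le_divide_eq mult.commute)
        then have "real (m + 1) * real (k ^ j) \<le> v * real m * real (k ^ j)"
          by (rule mult_right_mono) simp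
        also have "\<dots> = v * real (m * k ^ j)" by simp
        also have "\<dots> \<le> v * real n" using of_nat_mono[OF n2] v1 by (intro mult_left_mono) auto
        finally show ?thesis by (simp only: of_nat_mult)
      qed
      ultimately show ?thesis using n1 by (meson less_imp_le_nat)
    qed
  qed
  \<comment> \<open>Smaller powers of k give elements of at most \<open>q * k ^ j\<close>, larger
    ones start at \<open>q * k ^ Suc j\<close>, beyond \<open>p * k ^ j\<close>; with the same power
    the multiplier is at least p.\<close>
  have gap: "s \<ge> p * k ^ j" if s: "s \<in> S" "s > q * k ^ j" for s j
  proof -
    obtain m i where m: "s = m * k ^ i" "m \<in> M" using s by (auto simp: S_def)
    consider "i < j" | "i = j" | "i > j" by linarith
    then show ?thesis
    proof cases
      case 1
      then have "s < q * k ^ Suc i" using m(1) Mq(2)[OF m(2)] k by (simp add: mult_ac)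
      also have "\<dots> \<le> q * k ^ j" using 1 k by (intro mult_le_mono2 power_increasing) auto
      finally show ?thesis using s by simp
    next
      case 2
      then have "m \<ge> p" using m s by (auto simp: M_def)
      then show ?thesis using m 2 by simp
    next
      case 3
      have "p * k ^ j \<le> q * k ^ Suc j" using k(3) by (simp add: mult_ac)
      also have "\<dots> \<le> q * k ^ i" using 3 k by (intro mult_le_mono2 power_increasing) auto
      also have "\<dots> \<le> s" using m(1) Mq(1)[OF m(2)] by simp
      finally show ?thesis .
    qed
  qed
  interpret binary_digits b d
    by unfold_locales (use b in \<open>auto simp: d_S\<close>)
  have "\<exists>\<xi>. base_expansion b \<xi> d \<and> v_exp b \<xi> = ereal (v - 1)"
  proof (rule expansion_criterion)
    show "v \<ge> 1" using v1 by simp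
  next
    fix \<epsilon> :: real assume "\<epsilon> > 0"
    show "\<forall>\<^sub>F n in sequentially. \<exists>s\<ge>n. real s \<le> (v + \<epsilon>) * real n \<and> d s = 1"
    proof (rule eventually_sequentiallyI[of q])
      fix n assume "q \<le> n"
      then obtain s where s: "s \<ge> n" "real s \<le> v * real n" "s \<in> S" using next_S by blast
      have "v * real n \<le> (v + \<epsilon>) * real n" using \<open>\<epsilon> > 0\<close> by (intro mult_right_mono) auto
      then show "\<exists>s\<ge>n. real s \<le> (v + \<epsilon>) * real n \<and> d s = 1" using s d_S by force
    qed
  next
    fix \<epsilon> :: real assume e: "\<epsilon> > 0"
    have "\<exists>n\<ge>N. \<forall>s\<ge>n. real s \<le> (v - \<epsilon>) * real n \<longrightarrow> d s = 0" for N
    proof -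
      obtain K :: nat where K: "real K > v / \<epsilon>" using reals_Archimedean2 by blast
      define j where "j = max N K"
      \<comment> \<open>Starting one place behind the digit one turns \<open>p * k ^ j\<close> into
        \<open>v * n - v\<close>; the choice of \<open>K\<close> makes \<open>\<epsilon> * n\<close>
        exceed this loss of \<open>v\<close>.\<close>
      define n where "n = q * k ^ j + 1"
      have "j < 2 ^ j" by (rule less_exp)
      also have "(2::nat) ^ j \<le> k ^ j" using k by (intro power_mono) auto
      also have "\<dots> \<le> q * k ^ j" using q by simp
      finally have nj: "n > j" by (simp add: n_def)
      then have "real n > v / \<epsilon>" using K by (simp add: j_def)
      then have en: "\<epsilon> * real n > v" using e by (simp add: field_simps)
      have "d s = 0" if s: "s \<ge> n" "real s \<le> (v - \<epsilon>) * real n" for s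
      proof (rule ccontr)
        assume "d s \<noteq> 0"
        then have "s \<in> S" by (auto simp: d_S split: if_splits)
        then have "real (p * k ^ j) \<le> real s" using gap s by (simp only: of_nat_le_iff) (simp add: n_def)
        moreover have "real (p * k ^ j) = v * real n - v" using q by (simp add: v_def n_def field_simps)
        ultimately show False using s(2) en by (simp add: algebra_simps)
      qed
      then show ?thesis using nj by (intro exI[of _ n]) (auto simp: j_def)
    qed
    then show "\<exists>\<^sub>F n in sequentially. \<forall>s\<ge>n. real s \<le> (v - \<epsilon>) * real n \<longrightarrow> d s = 0"
      by (auto simp: frequently_sequentially)
  next
    show "\<forall>\<^sub>F n in sequentially. d n = 0 \<or> d (Suc n) = 0"
    proof (rule eventually_sequentiallyI[of "k * q"])
      fix n assume n: "k * q \<le> n"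
      \<comment> \<open>Ones beyond \<open>k * q\<close> sit at multiples of k \<ge> 2, hence never
        at neighbouring positions.\<close>
      have kd: "k dvd i" if "i \<in> S" "i \<ge> k * q" for i
      proof -
        have "i div k \<ge> q" using that k by (simp add: less_eq_div_iff_mult_less_eq mult.commute)
        then have "i mod k = 0" using S_step[of "i div k" "i mod k"] that k by simp
        then show ?thesis by auto
      qed
      show "d n = 0 \<or> d (Suc n) = 0"
      proof (rule ccontr)
        assume "\<not> (d n = 0 \<or> d (Suc n) = 0)"
        then have "k dvd n" "k dvd Suc n" using n by (auto intro!: kd simp: d_S split: if_splits)
        then have "k dvd 1" by (metis dvd_add_right_iff Suc_eq_plus1)
        then show False using k by simp
      qed
    qed
  qed
  then show ?thesis using \<open>automatic d\<close> by (auto simp: v_def)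
qed

text \<open>The periodic word 0101... has bounded gaps and isolated ones. The bound from below is
  vacuous here, because no s \<ge> n \<ge> 1 satisfies s \<le> (1 - \<epsilon>) n.\<close>

lemma rational_exponent_1:
  fixes b :: nat
  assumes b: "b \<ge> 2"
  shows "\<exists>\<xi> d. base_expansion b \<xi> d \<and> automatic d \<and> v_exp b \<xi> = 0"
proof -
  define d where "d n = n mod 2" for n :: nat
  have "automatic (id \<circ> d)"
  proof (rule automaticI)
    show "finite {0, 1::nat}" by simp
    show "is_morphism {0, 1} (\<lambda>_. [0, 1])" by (simp add: is_morphism_def)
    show "\<forall>c\<in>{0, 1::nat}. length [0, 1::nat] = 2" by simp
    show "d (2 * n + r) = [0, 1] ! r" if "r < 2" for n r
      using that by (auto simp: d_def less_2_cases_iff)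
  qed (auto simp: d_def)
  interpret binary_digits b d
    by unfold_locales (use b in \<open>auto simp: d_def\<close>)
  have "\<exists>\<xi>. base_expansion b \<xi> d \<and> v_exp b \<xi> = ereal (1 - 1)"
  proof (rule expansion_criterion)
    fix \<epsilon> :: real assume e: "\<epsilon> > 0"
    show "\<forall>\<^sub>F n in sequentially. \<exists>s\<ge>n. real s \<le> (1 + \<epsilon>) * real n \<and> d s = 1"
    proof (rule eventually_sequentiallyI[of "nat \<lceil>1 / \<epsilon>\<rceil>"])
      fix n assume "nat \<lceil>1 / \<epsilon>\<rceil> \<le> n"
      then have "1 / \<epsilon> \<le> real n" by auto
      then have "real (n + 1) \<le> (1 + \<epsilon>) * real n" using e by (simp add: field_simps)
      moreover have "real n \<le> (1 + \<epsilon>) * real n" using e by (simp add: algebra_simps)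
      moreover have "d n = 1 \<or> d (n + 1) = 1" by (simp add: d_def) presburger
      ultimately show "\<exists>s\<ge>n. real s \<le> (1 + \<epsilon>) * real n \<and> d s = 1"
        by (metis le_add1 order_refl)
    qed
    show "\<exists>\<^sub>F n in sequentially. \<forall>s\<ge>n. real s \<le> (1 - \<epsilon>) * real n \<longrightarrow> d s = 0"
    proof (rule eventually_frequently)
      show "\<forall>\<^sub>F n in sequentially. \<forall>s\<ge>n. real s \<le> (1 - \<epsilon>) * real n \<longrightarrow> d s = 0"
      proof (rule eventually_sequentiallyI[of 1], intro allI impI)
        fix n s :: nat assume n: "1 \<le> n" "n \<le> s" "real s \<le> (1 - \<epsilon>) * real n"
        have "\<epsilon> * real n > 0" using e n by simp
        then show "d s = 0" using n by (simp add: algebra_simps)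
      qed
    qed simp
  next
    show "\<forall>\<^sub>F n in sequentially. d n = 0 \<or> d (Suc n) = 0"
      by (rule always_eventually) (simp add: d_def, presburger)
  qed simp
  then show ?thesis using \<open>automatic (id \<circ> d)\<close> by (auto simp: zero_ereal_def)
qed

lemma rational_exponent:
  fixes b :: nat and v :: real
  assumes b: "b \<ge> 2" and v: "v \<in> \<rat>" "v \<ge> 1"
  shows "\<exists>\<xi> d. base_expansion b \<xi> d \<and> automatic d \<and> v_exp b \<xi> = ereal (v - 1)"
proof (cases "v = 1")
  case True
  then show ?thesis using rational_exponent_1[OF b] by (simp add: zero_ereal_def)
next
  case False
  obtain p q :: nat where pq: "q \<noteq> 0" "\<bar>v\<bar> = real p / real q"
    using Rats_abs_nat_div_natE[OF v(1)] by metis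
  then have "v = real p / real q" using v by simp
  moreover have "q < p" using v False calculation pq(1) by (simp add: field_simps)
  ultimately show ?thesis using rational_exponent_gt_1[OF b, of q p] pq by auto
qed

section \<open>Minimal polynomials of Perron numbers\<close>

abbreviation rat_poly :: "int poly \<Rightarrow> rat poly" where
  "rat_poly \<equiv> map_poly of_int"

lemma monic_degree_0:
  fixes p :: "'a :: comm_semiring_1 poly"
  assumes "lead_coeff p = 1" "degree p = 0"
  shows "p = 1"
  using assms by (elim degree_eq_zeroE) (simp add: one_pCons)

lemma rat_poly_mult: "rat_poly (p * q) = rat_poly p * rat_poly q"
  by (rule poly_eqI) (simp add: coeff_map_poly coeff_mult)

lemma map_poly_of_rat_mult:
  "map_poly (of_rat :: rat \<Rightarrow> 'a :: field_char_0) (p * q) = map_poly of_rat p * map_poly of_rat q"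
  by (rule poly_eqI) (simp add: coeff_map_poly coeff_mult of_rat_sum of_rat_mult)

lemma map_poly_of_rat_add:
  "map_poly (of_rat :: rat \<Rightarrow> 'a :: field_char_0) (p + q) = map_poly of_rat p + map_poly of_rat q"
  by (rule poly_eqI) (simp add: coeff_map_poly of_rat_add)

lemma map_poly_of_rat_rat_poly:
  "map_poly (of_rat :: rat \<Rightarrow> 'a :: field_char_0) (rat_poly p) = map_poly of_int p"
  by (rule poly_eqI) (simp add: coeff_map_poly)

text \<open>Denominators are cleared coefficient by coefficient and the content is divided out; this
  prepares Gauss's lemma.\<close>

lemma rat_poly_primitive_multiple:
  fixes p :: "rat poly"
  assumes "p \<noteq> 0"
  shows "\<exists>c P. c \<noteq> 0 \<and> content P = 1 \<and> smult c p = rat_poly P"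
proof -
  have "\<exists>m::int. m > 0 \<and> (\<forall>i\<le>n. of_int m * coeff p i \<in> \<int>)" for n
  proof (induction n)
    case 0
    obtain a b where "quotient_of (coeff p 0) = (a, b)" by fastforce
    then have "b > 0" "of_int b * coeff p 0 = of_int a"
      using quotient_of_denom_pos quotient_of_div[of "coeff p 0" a b] by (auto simp: field_simps)
    then show ?case by (intro exI[of _ b]) auto
  next
    case (Suc n)
    then obtain m where m: "m > 0" "\<And>i. i \<le> n \<Longrightarrow> of_int m * coeff p i \<in> \<int>" by blast
    obtain a b where "quotient_of (coeff p (Suc n)) = (a, b)" by fastforce
    then have b: "b > 0" "of_int b * coeff p (Suc n) = of_int a"
      using quotient_of_denom_pos quotient_of_div[of "coeff p (Suc n)" a b] by (auto simp: field_simps)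
    have "of_int (m * b) * coeff p i \<in> \<int>" if "i \<le> Suc n" for i
    proof (cases "i = Suc n")
      case True
      have "of_int (m * b) * coeff p i = of_int m * (of_int b * coeff p i)" by simp
      also have "\<dots> = of_int m * of_int a" using True b(2) by simp
      finally show ?thesis by (metis Ints_of_int of_int_mult)
    next
      case False
      then have "of_int b * (of_int m * coeff p i) \<in> \<int>" using that by (intro Ints_mult[OF Ints_of_int m(2)]) simp
      then show ?thesis by (simp add: mult_ac)
    qed
    then show ?case using m b by (intro exI[of _ "m * b"]) auto
  qed
  then obtain m :: int where m: "m > 0" "\<And>i. i \<le> degree p \<Longrightarrow> of_int m * coeff p i \<in> \<int>" by blast
  define Q where "Q = map_poly floor (smult (of_int m) p)"
  have Q: "rat_poly Q = smult (of_int m) p"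
  proof (rule poly_eqI)
    fix i show "coeff (rat_poly Q) i = coeff (smult (of_int m) p) i"
      using m(2)[of i] by (cases "i \<le> degree p") (auto simp: Q_def coeff_map_poly coeff_eq_0)
  qed
  have "Q \<noteq> 0" using Q m(1) assms by auto
  then have c: "content Q \<noteq> 0" "content (primitive_part Q) = 1" by auto
  have "smult (of_int (content Q)) (rat_poly (primitive_part Q)) = rat_poly Q"
  proof (rule poly_eqI)
    fix i
    have "content Q * coeff (primitive_part Q) i = coeff Q i"
      using content_times_primitive_part[of Q] by (metis coeff_smult)
    then show "coeff (smult (of_int (content Q)) (rat_poly (primitive_part Q))) i = coeff (rat_poly Q) i"
      by (simp add: coeff_map_poly flip: of_int_mult)
  qed
  then have "rat_poly (primitive_part Q) = smult (1 / of_int (content Q)) (rat_poly Q)"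
    using c by (metis (no_types, lifting) divide_inverse left_inverse mult.left_neutral of_int_eq_0_iff smult_1_left smult_smult)
  also have "\<dots> = smult (of_int m / of_int (content Q)) p" by (simp add: Q)
  finally show ?thesis using c m(1)
    by (intro exI[of _ "of_int m / of_int (content Q)"] exI[of _ "primitive_part Q"]) auto
qed

text \<open>A form of Gauss's lemma. Scaling the factors to primitive \<open>P\<close> and
  \<open>R\<close>, their product is primitive, yet it is \<open>lead_coeff P * lead_coeff R\<close>
  times the primitive \<open>q\<close>; so both leading coefficients are 1 or -1.\<close>

lemma monic_factor_integral:
  fixes p r :: "rat poly" and q :: "int poly"
  assumes "lead_coeff p = 1" "lead_coeff q = 1" "rat_poly q = p * r"
  shows "\<exists>P. lead_coeff P = 1 \<and> rat_poly P = p"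
proof -
  have "rat_poly q \<noteq> 0"
    using assms(2) by (metis leading_coeff_0_iff map_poly_eq_0_iff of_int_eq_0_iff zero_neq_one)
  then have "p \<noteq> 0" "r \<noteq> 0" using assms(3) by auto
  then obtain a P b R where
    P: "a \<noteq> 0" "content P = 1" "smult a p = rat_poly P" and
    R: "b \<noteq> 0" "content R = 1" "smult b r = rat_poly R"
    using rat_poly_primitive_multiple by metis
  have lead: "lead_coeff (rat_poly f) = of_int (lead_coeff f)" for f :: "int poly"
    by (simp add: coeff_map_poly degree_map_poly)
  have "lead_coeff (p * r) = 1" using assms(2) lead[of q] by (simp add: assms(3)[symmetric])
  then have lr: "lead_coeff r = 1" using assms(1) by (simp add: lead_coeff_mult)
  have a: "a = of_int (lead_coeff P)" using lead[of P] P(1) P(3)[symmetric] assms(1) by simp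
  have b: "b = of_int (lead_coeff R)" using lead[of R] R(1) R(3)[symmetric] lr by simp
  have "rat_poly (P * R) = smult (a * b) (rat_poly q)"
    by (simp add: rat_poly_mult P(3)[symmetric] R(3)[symmetric] assms(3) mult.commute)
  also have "\<dots> = rat_poly (smult (lead_coeff P * lead_coeff R) q)"
    by (rule poly_eqI) (simp add: coeff_map_poly a b)
  finally have "P * R = smult (lead_coeff P * lead_coeff R) q"
    by (intro poly_eqI) (metis coeff_map_poly of_int_0 of_int_eq_iff)
  then have "content (P * R) = normalize (lead_coeff P * lead_coeff R) * content q" by simp
  moreover have "content q = 1"
  proof -
    have "content q dvd lead_coeff q" by (rule content_dvd_coeff)
    then have "is_unit (content q)" using assms(2) by simp
    then show ?thesis by (metis normalize_content is_unit_normalize)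
  qed
  moreover have "content (P * R) = 1" using P R by (simp add: content_mult)
  ultimately have "\<bar>lead_coeff P * lead_coeff R\<bar> = 1" by simp
  then have "\<bar>lead_coeff P\<bar> = 1" by (rule abs_zmult_eq_1)
  then consider "lead_coeff P = 1" | "lead_coeff P = -1" by linarith
  then show ?thesis
  proof cases
    case 1
    then show ?thesis using P(3) a by (intro exI[of _ P]) simp
  next
    case 2
    have "rat_poly (- P) = - rat_poly P" by (rule poly_eqI) (simp add: coeff_map_poly)
    then have "rat_poly (- P) = p" using P(3)[symmetric] a 2 by simp
    then show ?thesis using 2 by (intro exI[of _ "- P"]) simp
  qed
qed

text \<open>Normalise a nonzero annihilating polynomial of least degree. Division with remainder
  shows that it divides every annihilating polynomial; in a factorisation one factor annihilates
  \<open>x\<close> and so has full degree, which leaves a unit as the other.\<close>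

lemma minimal_polynomial_exists:
  fixes x :: complex and q :: "rat poly"
  assumes "q \<noteq> 0" "poly (map_poly of_rat q) x = 0"
  shows "\<exists>p. is_min_poly p x \<and>
    (\<forall>f. poly (map_poly of_rat f) x = 0 \<longrightarrow> p dvd f)"
proof -
  define R where "R f \<longleftrightarrow> f \<noteq> 0 \<and> poly (map_poly of_rat f) x = 0" for f :: "rat poly"
  define p0 where "p0 = arg_min degree R"
  have p0: "R p0" "\<And>f. R f \<Longrightarrow> degree p0 \<le> degree f"
    using arg_min_nat_lemma[of R q degree] assms by (auto simp: R_def p0_def)
  define p where "p = smult (inverse (lead_coeff p0)) p0"
  have lp: "lead_coeff p = 1" using p0(1) by (simp add: p_def R_def)
  have degp: "degree p = degree p0" using p0(1) by (simp add: p_def R_def)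
  have smult_rat: "map_poly (of_rat :: rat \<Rightarrow> complex) (smult c f) = smult (of_rat c) (map_poly of_rat f)" for c f
    by (rule poly_eqI) (simp add: coeff_map_poly of_rat_mult)
  have px: "poly (map_poly of_rat p) x = 0" using p0(1) by (simp add: p_def R_def smult_rat)
  have small: "f = 0" if "poly (map_poly of_rat f) x = 0" "degree f < degree p" for f
    using p0(2)[of f] that degp by (auto simp: R_def)
  have dvd: "p dvd f" if f: "poly (map_poly of_rat f) x = 0" for f
  proof -
    have "f = p * (f div p) + f mod p" by simp
    then have "poly (map_poly of_rat f) x
        = poly (map_poly of_rat p) x * poly (map_poly of_rat (f div p)) x + poly (map_poly of_rat (f mod p)) x"
      by (metis map_poly_of_rat_add map_poly_of_rat_mult poly_add poly_mult)
    then have 0: "poly (map_poly of_rat (f mod p)) x = 0" using f px by simp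
    have "f mod p = 0"
    proof (cases "degree p = 0")
      case True
      then have "p = 1" using monic_degree_0[OF lp] by simp
      then show ?thesis by simp
    next
      case False
      then show ?thesis using small[OF 0] degree_mod_less[of p f] lp by fastforce
    qed
    then show ?thesis by auto
  qed
  have dp: "degree p > 0"
  proof (rule ccontr)
    assume "\<not> degree p > 0"
    then have "p = 1" using monic_degree_0[OF lp] by simp
    then show False using px by simp
  qed
  have p_nz: "p \<noteq> 0" using lp by auto
  have "irreducible p"
  proof (rule irreducibleI)
    show "p \<noteq> 0" by (rule p_nz)
    show "\<not> p dvd 1" using dp by (simp add: is_unit_iff_degree[OF p_nz])
    fix f g assume fg: "p = f * g"
    then have nz: "f \<noteq> 0" "g \<noteq> 0" using lp by auto
    have d: "degree p = degree f + degree g" using fg nz by (simp add: degree_mult_eq)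
    have "poly (map_poly of_rat f) x = 0 \<or> poly (map_poly of_rat g) x = 0"
      using px unfolding fg map_poly_of_rat_mult poly_mult mult_eq_0_iff .
    then have "degree f \<ge> degree p \<or> degree g \<ge> degree p" using small nz not_less by blast
    then show "f dvd 1 \<or> g dvd 1" using d nz by (auto simp: is_unit_iff_degree)
  qed
  then show ?thesis using lp px dvd unfolding is_min_poly_def by blast
qed

text \<open>The minimal polynomial over the rationals is integral by
  \<open>monic_factor_integral\<close>, and its other complex roots are the Galois conjugates. It
  cannot divide its derivative, which is nonzero of smaller degree, so \<open>v\<close> is a simple
  root.\<close>

lemma perron_integer_polynomial:
  assumes "perron_number v"
  shows "\<exists>p :: int poly. lead_coeff p = 1 \<and> poly (map_poly of_int p) v = 0 \<and>
     poly (pderiv (map_poly of_int p)) v \<noteq> 0 \<and>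
     (\<forall>z::complex. poly (map_poly of_int p) z = 0 \<longrightarrow> z \<noteq> of_real v \<longrightarrow> cmod z < v)"
proof -
  obtain q :: "int poly" where q: "poly (map_poly of_int q) v = 0" "lead_coeff q = 1"
    using assms algebraic_int_altdef_ipoly unfolding perron_number_def by blast
  have of_real_poly: "poly (map_poly of_int f) (complex_of_real y) = of_real (poly (map_poly of_int f) y)"
    for f :: "int poly" and y :: real
    by (induction f) (auto simp: map_poly_pCons)
  have "rat_poly q \<noteq> 0"
    using q(2) by (metis leading_coeff_0_iff map_poly_eq_0_iff of_int_eq_0_iff zero_neq_one)
  moreover have "poly (map_poly of_rat (rat_poly q)) (complex_of_real v) = 0"
    by (simp add: map_poly_of_rat_rat_poly of_real_poly q)
  ultimately obtain p where p: "is_min_poly p (complex_of_real v)"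
    and dvd: "\<And>f. poly (map_poly of_rat f) (complex_of_real v) = 0 \<Longrightarrow> p dvd f"
    using minimal_polynomial_exists by blast
  obtain r where "rat_poly q = p * r"
    using dvd[OF \<open>poly (map_poly of_rat (rat_poly q)) (complex_of_real v) = 0\<close>] by (auto simp: dvd_def)
  then obtain P :: "int poly" where P: "lead_coeff P = 1" "rat_poly P = p"
    using monic_factor_integral[of p q r] p q(2) by (auto simp: is_min_poly_def)
  have root: "poly (map_poly of_rat p) z = poly (map_poly of_int P) z" for z :: complex
    by (simp add: P(2)[symmetric] map_poly_of_rat_rat_poly)
  have conj: "cmod z < v" if "poly (map_poly of_int P) z = 0" "z \<noteq> of_real v" for z :: complex
  proof -
    have "z \<in> galois_conjugates (of_real v)"
      using p that(1) root[of z] by (auto simp: galois_conjugates_def)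
    then show ?thesis using assms that(2) by (simp add: perron_number_def)
  qed
  have Pv: "poly (map_poly of_int P) v = 0"
    using p root[of "complex_of_real v"] of_real_poly[of P v] by (auto simp: is_min_poly_def)
  have "poly (pderiv (map_poly of_int P)) v \<noteq> 0"
  proof
    assume d0: "poly (pderiv (map_poly of_int P)) v = 0"
    have pd: "pderiv (map_poly of_int P) = map_poly real_of_int (pderiv P)"
      by (rule poly_eqI) (simp add: coeff_map_poly coeff_pderiv)
    have "poly (map_poly of_rat (rat_poly (pderiv P))) (complex_of_real v) = 0"
      using d0 by (simp add: map_poly_of_rat_rat_poly of_real_poly pd)
    then have "p dvd rat_poly (pderiv P)" by (rule dvd)
    moreover have dP: "degree P > 0"
    proof (rule ccontr)
      assume "\<not> degree P > 0"
      then have "P = 1" using monic_degree_0[OF P(1)] by simp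
      then show False using Pv by simp
    qed
    moreover have "rat_poly (pderiv P) \<noteq> 0"
      using dP by (simp add: map_poly_eq_0_iff pderiv_eq_0_iff)
    ultimately have "degree p \<le> degree (rat_poly (pderiv P))" by (intro dvd_imp_degree_le)
    moreover have "degree p = degree P" by (simp add: P(2)[symmetric] degree_map_poly)
    moreover have "degree (rat_poly (pderiv P)) = degree P - 1"
      by (simp add: degree_map_poly degree_pderiv)
    ultimately show False using dP by simp
  qed
  then show ?thesis using P(1) Pv conj by blast
qed

section \<open>Linear recurrences\<close>

text \<open>Once \<open>y\<close> is small, the contraction forgets the starting value geometrically
  and leaves only an error controlled by \<open>y\<close>.\<close>

lemma contracting_recurrence_tendsto_0:
  fixes x y :: "nat \<Rightarrow> 'a :: real_normed_field"
  assumes "norm z < 1" "y \<longlonglongrightarrow> 0" "\<And>n. x (Suc n) = z * x n + y n"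
  shows "x \<longlonglongrightarrow> 0"
proof (rule LIMSEQ_I)
  fix e :: real assume e: "e > 0"
  define r where "r = norm z"
  have r: "0 \<le> r" "r < 1" using assms(1) by (auto simp: r_def)
  \<comment> \<open>Chosen so that \<open>r * (e / 2) + e' = e / 2\<close>, which lets the
    recurrence preserve the bound below.\<close>
  define e' where "e' = e * (1 - r) / 2"
  have e': "e' > 0" using e r by (simp add: e'_def)
  obtain N where N: "\<And>n. n \<ge> N \<Longrightarrow> norm (y n) < e'"
    using LIMSEQ_D[OF assms(2) e'] by auto
  have bound: "norm (x (N + k)) \<le> r ^ k * norm (x N) + e / 2" for k
  proof (induction k)
    case 0
    then show ?case using e by simp
  next
    case (Suc k)
    have "norm (x (N + Suc k)) \<le> r * norm (x (N + k)) + norm (y (N + k))"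
      using norm_triangle_ineq[of "z * x (N + k)" "y (N + k)"] assms(3)[of "N + k"]
      by (simp add: r_def norm_mult)
    also have "\<dots> \<le> r * (r ^ k * norm (x N) + e / 2) + e'"
      using Suc r N[of "N + k"] by (intro add_mono mult_left_mono) auto
    also have "\<dots> = r ^ Suc k * norm (x N) + e / 2" by (simp add: e'_def field_simps)
    finally show ?case .
  qed
  have "(\<lambda>k. r ^ k * norm (x N)) \<longlonglongrightarrow> 0 * norm (x N)"
    by (intro tendsto_mult LIMSEQ_realpow_zero tendsto_const) (use r in auto)
  then obtain K where K: "\<And>k. k \<ge> K \<Longrightarrow> r ^ k * norm (x N) < e / 2"
    using order_tendstoD(2)[of _ "0 * norm (x N)" sequentially "e / 2"] e
    by (auto simp: eventually_sequentially)
  show "\<exists>no. \<forall>n\<ge>no. norm (x n - 0) < e"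
  proof (intro exI[of _ "N + K"] allI impI)
    fix n assume "n \<ge> N + K"
    then have "norm (x n) \<le> r ^ (n - N) * norm (x N) + e / 2" "r ^ (n - N) * norm (x N) < e / 2"
      using bound[of "n - N"] K[of "n - N"] by auto
    then show "norm (x n - 0) < e" by simp
  qed
qed

text \<open>The shift operator on sequences makes them a module over polynomials.\<close>
definition shift_poly :: "'a :: comm_ring_1 poly \<Rightarrow> (nat \<Rightarrow> 'a) \<Rightarrow> nat \<Rightarrow> 'a" where
  "shift_poly p a n = (\<Sum>i\<le>degree p. coeff p i * a (n + i))"

lemma shift_poly_bound:
  assumes "degree p \<le> m"
  shows "shift_poly p a n = (\<Sum>i\<le>m. coeff p i * a (n + i))"
  unfolding shift_poly_def
  by (rule sum.mono_neutral_left) (use assms in \<open>auto simp: coeff_eq_0\<close>)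

lemma shift_poly_0 [simp]: "shift_poly 0 a = (\<lambda>_. 0)"
  by (rule ext) (simp add: shift_poly_def)

lemma shift_poly_pCons: "shift_poly (pCons c p) a n = c * a n + shift_poly p a (Suc n)"
proof -
  have "shift_poly (pCons c p) a n = (\<Sum>i\<le>Suc (degree p). coeff (pCons c p) i * a (n + i))"
    by (rule shift_poly_bound) (simp add: degree_pCons_eq_if)
  also have "\<dots> = c * a n + (\<Sum>i\<le>degree p. coeff p i * a (Suc n + i))"
    by (subst sum.atMost_Suc_shift) simp
  finally show ?thesis by (simp add: shift_poly_def)
qed

lemma shift_poly_add_seq: "shift_poly p (\<lambda>n. a n + b n) n = shift_poly p a n + shift_poly p b n"
  by (simp add: shift_poly_def algebra_simps sum.distrib)

lemma shift_poly_diff_seq: "shift_poly p (\<lambda>n. a n - b n) n = shift_poly p a n - shift_poly p b n"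
  by (simp add: shift_poly_def algebra_simps sum_subtractf)

lemma shift_poly_scale_seq: "shift_poly p (\<lambda>n. c * a n) n = c * shift_poly p a n"
  by (simp add: shift_poly_def sum_distrib_left algebra_simps)

lemma shift_poly_shift: "shift_poly p (\<lambda>n. a (n + k)) n = shift_poly p a (n + k)"
  by (simp add: shift_poly_def add_ac)

lemma shift_poly_power: "shift_poly p (\<lambda>n. x ^ n) n = x ^ n * poly p x"
  by (simp add: shift_poly_def poly_altdef power_add sum_distrib_left algebra_simps)

lemma shift_poly_add: "shift_poly (p + q) a n = shift_poly p a n + shift_poly q a n"
  using shift_poly_bound[of p "max (degree p) (degree q)" a n]
    shift_poly_bound[of q "max (degree p) (degree q)" a n]
    shift_poly_bound[OF degree_add_le_max, of p q a n]
  by (simp add: algebra_simps sum.distrib)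

lemma shift_poly_smult: "shift_poly (smult c p) a n = c * shift_poly p a n"
  using shift_poly_bound[of "smult c p" "degree p" a n] degree_smult_le[of c p]
  by (simp add: shift_poly_def sum_distrib_left mult.assoc)

text \<open>Products of polynomials act as compositions, so factoring a polynomial factors its
  recurrence.\<close>

lemma shift_poly_mult: "shift_poly (p * q) a n = shift_poly p (shift_poly q a) n"
proof (induction p arbitrary: n)
  case (pCons c p)
  then show ?case
    by (simp add: mult_pCons_left shift_poly_add shift_poly_smult shift_poly_pCons)
qed simp

text \<open>Splitting off one root at a time reduces the claim to first-order recurrences.\<close>
lemma recurrence_growth:
  fixes f :: "complex poly" and a :: "nat \<Rightarrow> complex"
  assumes "f \<noteq> 0" "v > 0" "\<And>z. poly f z = 0 \<Longrightarrow> cmod z < v"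
    and "(\<lambda>n. shift_poly f a n / of_real v ^ n) \<longlonglongrightarrow> 0"
  shows "(\<lambda>n. a n / of_real v ^ n) \<longlonglongrightarrow> 0"
  using assms
proof (induction "degree f" arbitrary: f a)
  case 0
  then obtain c where c: "f = [:c:]" "c \<noteq> 0" by (metis degree_eq_zeroE pCons_eq_0_iff)
  then have "(\<lambda>n. inverse c * (shift_poly f a n / of_real v ^ n)) \<longlonglongrightarrow> inverse c * 0"
    using 0 by (intro tendsto_mult tendsto_const)
  moreover have "inverse c * (shift_poly f a n / of_real v ^ n) = a n / of_real v ^ n" for n
    using c by (simp add: shift_poly_pCons)
  ultimately show ?case by (simp only: mult_zero_right)
next
  case (Suc k)
  obtain z where z: "poly f z = 0"
    using fundamental_theorem_of_algebra_alt[of f] Suc.hyps(2) by (metis degree_pCons_0 nat.distinct(1))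
  then obtain g where g: "f = g * [:- z, 1:]" by (metis poly_eq_0_iff_dvd dvd_def mult.commute)
  have gz: "g \<noteq> 0" using g Suc.prems(1) by auto
  have "degree f = degree g + degree [:- z, 1:]"
    unfolding g by (rule degree_mult_eq) (use gz in auto)
  then have deg: "k = degree g" using Suc.hyps(2) by simp
  \<comment> \<open>The induction hypothesis for \<open>g\<close> applies to \<open>b\<close>.
    Conversely, after division by powers of v, \<open>a\<close> arises from \<open>b\<close> by a
    first-order recurrence with factor z / v of modulus below 1.\<close>
  define b where "b n = shift_poly [:- z, 1:] a n" for n
  have b: "b n = a (Suc n) - z * a n" for n by (simp add: b_def shift_poly_pCons)
  have fg: "shift_poly f a n = shift_poly g b n" for n
    unfolding g shift_poly_mult b_def[abs_def] ..
  have "(\<lambda>n. b n / of_real v ^ n) \<longlonglongrightarrow> 0"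
  proof (rule Suc.hyps(1)[OF deg gz \<open>v > 0\<close>])
    show "cmod y < v" if "poly g y = 0" for y
      using Suc.prems(3)[of y] that unfolding g poly_mult by simp
    show "(\<lambda>n. shift_poly g b n / of_real v ^ n) \<longlonglongrightarrow> 0"
      using Suc.prems(4) unfolding fg .
  qed
  then have "(\<lambda>n. (b n / of_real v ^ n) * inverse (of_real v)) \<longlonglongrightarrow> 0 * inverse (of_real v)"
    by (intro tendsto_mult tendsto_const)
  then have lim: "(\<lambda>n. b n / of_real v ^ Suc n) \<longlonglongrightarrow> 0"
    by (simp add: field_simps)
  show ?case
  proof (rule contracting_recurrence_tendsto_0[of "z / of_real v", OF _ lim])
    show "norm (z / of_real v) < 1"
      using Suc.prems(2,3) z by (simp add: norm_divide)
    show "a (Suc n) / of_real v ^ Suc n = z / of_real v * (a n / of_real v ^ n) + b n / of_real v ^ Suc n" for n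
      using Suc.prems(2) by (simp add: b field_simps)
  qed
qed

section \<open>A finitely generated cone of recurrent sequences\<close>

lemma eventually_power_ge:
  fixes v K :: real
  assumes "v > 1"
  shows "eventually (\<lambda>n. v ^ n \<ge> K) sequentially"
proof -
  obtain m where "K < v ^ m" using real_arch_pow[OF assms] by blast
  then have "K \<le> v ^ n" if "n \<ge> m" for n
    using power_increasing[OF that, of v] assms by linarith
  then show ?thesis by (rule eventually_sequentiallyI)
qed

lemma map_poly_of_real_mult:
  "map_poly complex_of_real (f * g) = map_poly of_real f * map_poly of_real g"
  by (rule poly_eqI) (simp add: coeff_map_poly coeff_mult)

lemma poly_map_poly_of_real: "poly (map_poly complex_of_real f) (of_real x) = of_real (poly f x)"
  by (induction f) (auto simp: map_poly_pCons)

lemma shift_poly_of_real: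
  "shift_poly (map_poly complex_of_real f) (\<lambda>n. of_real (a n)) n = of_real (shift_poly f a n)"
  by (simp add: shift_poly_def coeff_map_poly degree_map_poly)

section \<open>Solutions of the recurrence and their dominant coefficient\<close>

locale perron_polynomial =
  fixes v :: real and p :: "int poly"
  assumes v1: "v > 1"
    and monic: "lead_coeff p = 1"
    and root: "poly (map_poly of_int p) v = 0"
    and simple: "poly (pderiv (map_poly of_int p)) v \<noteq> 0"
    and dominant: "\<And>z :: complex. poly (map_poly of_int p) z = 0 \<Longrightarrow> z \<noteq> of_real v \<Longrightarrow> cmod z < v"
begin

definition P :: "real poly" where "P = map_poly of_int p"
definition D :: nat where "D = degree p"
text \<open>The cofactor of the root \<open>v\<close>. Applied to a solution of the recurrence, it
  leaves a geometric sequence with ratio \<open>v\<close>.\<close>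

definition s :: "real poly" where "s = P div [:- v, 1:]"
definition recseq :: "(nat \<Rightarrow> real) \<Rightarrow> bool" where "recseq a \<longleftrightarrow> (\<forall>n. shift_poly P a n = 0)"

text \<open>The coefficient of \<open>v ^ n\<close> in a solution of the recurrence.\<close>
definition lead :: "(nat \<Rightarrow> real) \<Rightarrow> real" where "lead a = shift_poly s a 0 / poly s v"

text \<open>The first \<open>D\<close> terms determine a solution, so this measures the distance
  from the dominant direction; \<open>dev a \<le> lead a\<close> describes the cone.\<close>

definition dev :: "(nat \<Rightarrow> real) \<Rightarrow> real" where "dev a = (\<Sum>i<D. \<bar>a i - lead a * v ^ i\<bar>)"

lemma degree_P: "degree P = D" and coeff_P: "coeff P i = of_int (coeff p i)" and coeff_P_D: "coeff P D = 1"
  using monic by (simp_all add: P_def D_def degree_map_poly coeff_map_poly)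

lemma P_factor: "P = s * [:- v, 1:]"
proof -
  have "[:- v, 1:] dvd P" using root unfolding P_def poly_eq_0_iff_dvd .
  then show ?thesis by (simp only: s_def dvd_div_mult_self)
qed

lemma P_nz: "P \<noteq> 0" using coeff_P_D by auto

lemma s_nz: "s \<noteq> 0" using P_factor P_nz by auto

lemma degree_s: "D = Suc (degree s)"
proof -
  have "degree P = degree s + degree [:- v, 1:]"
    unfolding P_factor by (rule degree_mult_eq) (use s_nz in auto)
  then show ?thesis by (simp add: degree_P)
qed

lemma poly_s_v: "poly s v \<noteq> 0"
proof -
  have "pderiv P = s * pderiv [:- v, 1:] + [:- v, 1:] * pderiv s"
    by (simp only: P_factor pderiv_mult)
  then have "poly (pderiv P) v = poly s v" by (simp add: pderiv_pCons)
  then show ?thesis using simple by (simp add: P_def)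
qed

lemma roots_s:
  assumes z: "poly (map_poly complex_of_real s) z = 0"
  shows "cmod z < v"
proof (rule dominant)
  have "map_poly complex_of_int p = map_poly of_real P"
    by (rule poly_eqI) (simp add: coeff_map_poly P_def)
  then show "poly (map_poly complex_of_int p) z = 0"
    unfolding P_factor map_poly_of_real_mult poly_mult using z by simp
  show "z \<noteq> of_real v" using z poly_s_v by (auto simp: poly_map_poly_of_real)
qed

lemma shift_poly_s: "shift_poly s a n = (\<Sum>i<D. coeff s i * a (n + i))"
  unfolding shift_poly_def degree_s lessThan_Suc_atMost ..

lemma recseq_next:
  assumes "recseq a"
  shows "a (n + D) = - (\<Sum>i<D. coeff P i * a (n + i))"
proof -
  have "0 = (\<Sum>i\<le>D. coeff P i * a (n + i))"
    using assms by (simp add: recseq_def shift_poly_def degree_P)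
  also have "{..D} = insert D {..<D}" by auto
  finally show ?thesis by (simp add: coeff_P_D)
qed

lemma recseq_iff: "recseq a \<longleftrightarrow> (\<forall>n. a (n + D) = - (\<Sum>i<D. coeff P i * a (n + i)))"
proof
  assume r: "\<forall>n. a (n + D) = - (\<Sum>i<D. coeff P i * a (n + i))"
  have "{..D} = insert D {..<D}" by auto
  then show "recseq a" using r by (simp add: recseq_def shift_poly_def degree_P coeff_P_D)
qed (use recseq_next in blast)

lemma recseq_eqI:
  assumes "recseq a" "recseq b" "\<And>i. i < D \<Longrightarrow> a i = b i"
  shows "a = b"
proof
  fix n show "a n = b n"
  proof (induction n rule: less_induct)
    case (less n)
    show ?case
    proof (cases "n < D")
      case False
      then have "a (n - D + D) = b (n - D + D)"
        unfolding recseq_next[OF assms(1)] recseq_next[OF assms(2)]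
        by (intro arg_cong[of _ _ uminus] sum.cong refl) (use less False in auto)
      then show ?thesis using False by simp
    qed (use assms in simp)
  qed
qed

text \<open>Continues \<open>D\<close> initial values to a solution. As \<open>P\<close> is monic,
  no division occurs and integrality is preserved.\<close>

function extend :: "(nat \<Rightarrow> real) \<Rightarrow> nat \<Rightarrow> real" where
  "extend x n = (if n < D then x n else - (\<Sum>i<D. coeff P i * extend x (n - D + i)))"
  by pat_completeness auto
termination
proof (relation "Wellfounded.measure snd")
  show "((x, n - D + i), (x, n)) \<in> Wellfounded.measure snd"
    if "\<not> n < D" "i \<in> {..<D}" for x :: "nat \<Rightarrow> real" and n i
    using that by simp
qed simp

declare extend.simps [simp del]

lemma extend_less: "i < D \<Longrightarrow> extend x i = x i"
  by (simp add: extend.simps)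

lemma recseq_extend: "recseq (extend x)"
  unfolding recseq_iff by (subst extend.simps) simp

lemma extend_Ints:
  assumes "\<And>i. i < D \<Longrightarrow> x i \<in> \<int>"
  shows "extend x n \<in> \<int>"
proof (induction n rule: less_induct)
  case (less n)
  show ?case
  proof (cases "n < D")
    case False
    then have "(\<Sum>i<D. coeff P i * extend x (n - D + i)) \<in> \<int>"
      by (intro Ints_sum Ints_mult less) (auto simp: coeff_P)
    then show ?thesis using False by (subst extend.simps) simp
  qed (use assms in \<open>simp add: extend_less\<close>)
qed

lemma recseq_diff: "recseq a \<Longrightarrow> recseq b \<Longrightarrow> recseq (\<lambda>n. a n - b n)"
  and recseq_shift: "recseq a \<Longrightarrow> recseq (\<lambda>n. a (n + k))"
  by (simp_all add: recseq_def shift_poly_diff_seq shift_poly_shift)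

lemma lead_add: "lead (\<lambda>n. a n + b n) = lead a + lead b"
  and lead_diff: "lead (\<lambda>n. a n - b n) = lead a - lead b"
  and lead_scale: "lead (\<lambda>n. c * a n) = c * lead a"
  by (simp_all add: lead_def shift_poly_add_seq shift_poly_diff_seq shift_poly_scale_seq
      add_divide_distrib diff_divide_distrib)

lemma lead_cong:
  assumes "\<And>i. i < D \<Longrightarrow> a i = b i"
  shows "lead a = lead b"
  unfolding lead_def shift_poly_s using assms by simp

text \<open>Applying X - v to \<open>shift_poly s a\<close> gives \<open>shift_poly P a = 0\<close>,
  which is the first-order recurrence of a geometric sequence.\<close>

lemma shift_poly_s_recseq:
  assumes "recseq a"
  shows "shift_poly s a n = v ^ n * shift_poly s a 0"
proof (induction n)
  case (Suc n)
  have "P = [:- v, 1:] * s" by (simp add: P_factor mult.commute)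
  then have "shift_poly [:- v, 1:] (shift_poly s a) n = 0"
    using assms by (metis recseq_def shift_poly_mult)
  then show ?case using Suc by (simp add: shift_poly_pCons)
qed simp

lemma lead_shift:
  assumes "recseq a"
  shows "lead (\<lambda>n. a (n + k)) = v ^ k * lead a"
  using shift_poly_s_recseq[OF assms, of k] by (simp add: lead_def shift_poly_shift)

text \<open>Subtracting \<open>lead a * v ^ n\<close> yields a sequence annihilated by
  \<open>s\<close>, whose complex roots all have modulus below \<open>v\<close>; then
  \<open>recurrence_growth\<close> applies.\<close>

lemma recseq_asymptotics:
  assumes "recseq a"
  shows "(\<lambda>n. (a n - lead a * v ^ n) / v ^ n) \<longlonglongrightarrow> 0"
proof -
  define b where "b n = a n - lead a * v ^ n" for n
  have "shift_poly s b n = 0" for n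
  proof -
    have "shift_poly s b n = shift_poly s a n - lead a * (v ^ n * poly s v)"
      unfolding b_def[abs_def] shift_poly_diff_seq shift_poly_scale_seq shift_poly_power ..
    then show ?thesis using shift_poly_s_recseq[OF assms, of n] poly_s_v by (simp add: lead_def)
  qed
  then have sb: "shift_poly (map_poly complex_of_real s) (\<lambda>n. of_real (b n)) n = 0" for n
    by (simp add: shift_poly_of_real)
  have "(\<lambda>n. complex_of_real (b n) / of_real v ^ n) \<longlonglongrightarrow> 0"
  proof (rule recurrence_growth)
    show "map_poly complex_of_real s \<noteq> 0" using s_nz by (simp add: map_poly_eq_0_iff)
    show "v > 0" using v1 by simp
    show "(\<lambda>n. shift_poly (map_poly complex_of_real s) (\<lambda>n. of_real (b n)) n / of_real v ^ n) \<longlonglongrightarrow> 0"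
      by (simp add: sb)
  qed (rule roots_s)
  then have "(\<lambda>n. complex_of_real (b n / v ^ n)) \<longlonglongrightarrow> of_real 0" by simp
  then show ?thesis unfolding tendsto_of_real_iff b_def .
qed

text \<open>Shifting moves a solution with positive \<open>lead\<close> into the cone:
  \<open>lead\<close> grows exactly like v^n, while \<open>dev\<close> is of smaller order.\<close>

lemma dev_shift_tendsto:
  assumes "recseq a"
  shows "(\<lambda>n. dev (\<lambda>i. a (i + n)) / v ^ n) \<longlonglongrightarrow> 0"
proof -
  have "(\<lambda>n. \<Sum>i<D. v ^ i * \<bar>(a (n + i) - lead a * v ^ (n + i)) / v ^ (n + i)\<bar>)
      \<longlonglongrightarrow> (\<Sum>i<D. v ^ i * \<bar>0\<bar>)"
    by (intro tendsto_sum tendsto_mult tendsto_const tendsto_rabs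
        LIMSEQ_ignore_initial_segment[OF recseq_asymptotics[OF assms]])
  moreover have "(\<Sum>i<D. v ^ i * \<bar>(a (n + i) - lead a * v ^ (n + i)) / v ^ (n + i)\<bar>)
      = dev (\<lambda>i. a (i + n)) / v ^ n" for n
    unfolding dev_def lead_shift[OF assms] sum_divide_distrib
    using v1 by (intro sum.cong refl) (simp add: abs_divide power_add field_simps)
  ultimately show ?thesis by simp
qed

lemma dev_add: "dev (\<lambda>n. a n + b n) \<le> dev a + dev b"
  unfolding dev_def lead_add sum.distrib[symmetric]
  by (rule sum_mono) (simp add: algebra_simps)

lemma dev_diff: "dev (\<lambda>n. a n - b n) \<le> dev a + dev b"
  unfolding dev_def lead_diff sum.distrib[symmetric]
  by (rule sum_mono) (simp add: algebra_simps)

lemma dev_scale: "dev (\<lambda>n. c * a n) = \<bar>c\<bar> * dev a"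
  unfolding dev_def lead_scale sum_distrib_left abs_mult[symmetric]
  by (simp add: algebra_simps)

text \<open>Both quantities depend only on the first \<open>D\<close> entries. The bound measures
  what rounding errors of at most 1 in these entries can do.\<close>

lemma bounded_on_unit_cube:
  "\<exists>B\<ge>1. \<forall>a. (\<forall>i<D. \<bar>a i\<bar> \<le> 1) \<longrightarrow> \<bar>lead a\<bar> \<le> B \<and> dev a \<le> B"
proof -
  define B1 where "B1 = (\<Sum>i<D. \<bar>coeff s i\<bar>) / \<bar>poly s v\<bar>"
  define B2 where "B2 = (\<Sum>i<D. 1 + B1 * v ^ i)"
  have "\<bar>lead a\<bar> \<le> B1 \<and> dev a \<le> B2" if a: "\<forall>i<D. \<bar>a i\<bar> \<le> 1" for a
  proof
    have "\<bar>shift_poly s a 0\<bar> \<le> (\<Sum>i<D. \<bar>coeff s i * a i\<bar>)" by (simp add: shift_poly_s)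
    also have "\<dots> \<le> (\<Sum>i<D. \<bar>coeff s i\<bar>)"
      by (rule sum_mono) (use a in \<open>auto simp: abs_mult intro: mult_left_le\<close>)
    finally show l: "\<bar>lead a\<bar> \<le> B1"
      unfolding lead_def B1_def abs_divide by (rule divide_right_mono) simp
    have "\<bar>a i - lead a * v ^ i\<bar> \<le> 1 + B1 * v ^ i" if "i < D" for i
    proof -
      have "\<bar>lead a * v ^ i\<bar> \<le> B1 * v ^ i"
        using l v1 by (simp add: abs_mult mult_right_mono)
      moreover have "\<bar>a i\<bar> \<le> 1" using a that by simp
      ultimately show ?thesis by linarith
    qed
    then show "dev a \<le> B2" unfolding dev_def B2_def by (intro sum_mono) auto
  qed
  then show ?thesis by (intro exI[of _ "max 1 (max B1 B2)"]) (auto simp: le_max_iff_disj)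
qed

definition B :: real where
  "B = (SOME B. B \<ge> 1 \<and> (\<forall>a. (\<forall>i<D. \<bar>a i\<bar> \<le> 1) \<longrightarrow> \<bar>lead a\<bar> \<le> B \<and> dev a \<le> B))"

lemma B_ge_1: "B \<ge> 1"
  and lead_le_B: "(\<And>i. i < D \<Longrightarrow> \<bar>a i\<bar> \<le> 1) \<Longrightarrow> \<bar>lead a\<bar> \<le> B"
  and dev_le_B: "(\<And>i. i < D \<Longrightarrow> \<bar>a i\<bar> \<le> 1) \<Longrightarrow> dev a \<le> B"
  using someI_ex[OF bounded_on_unit_cube] unfolding B_def[symmetric] by blast+

text \<open>The integral points of the cone in a bounded range. The bound \<open>9 * B\<close> is
  the \<open>8 * B\<close> allowed for \<open>lead a / k\<close> in \<open>decompose\<close> plus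
  \<open>B\<close> for rounding.\<close>

definition generators :: "(nat \<Rightarrow> real) set" where
  "generators = {a. recseq a \<and> (\<forall>n. a n \<in> \<int>) \<and> dev a \<le> lead a \<and> 1 \<le> lead a \<and> lead a \<le> 9 * B}"

text \<open>Bounds on \<open>lead\<close> and \<open>dev\<close> bound the first \<open>D\<close>
  entries; these are integers and determine the sequence.\<close>

lemma finite_generators: "finite generators"
proof -
  define K where "K = 9 * B + 9 * B * v ^ D"
  define X where "X = PiE {..<D} (\<lambda>_. real_of_int ` {- \<lceil>K\<rceil>..\<lceil>K\<rceil>})"
  have "restrict a {..<D} \<in> X" if a: "a \<in> generators" for a
  proof -
    have "a i \<in> real_of_int ` {- \<lceil>K\<rceil>..\<lceil>K\<rceil>}" if i: "i < D" for i
    proof -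
      have "\<bar>a i - lead a * v ^ i\<bar> \<le> dev a"
        unfolding dev_def using i by (intro member_le_sum) auto
      also have "\<dots> \<le> 9 * B" using a by (simp add: generators_def)
      finally have "\<bar>a i\<bar> \<le> 9 * B + \<bar>lead a * v ^ i\<bar>" by linarith
      also have "\<bar>lead a * v ^ i\<bar> \<le> 9 * B * v ^ D"
      proof -
        have "v ^ i \<le> v ^ D" using i v1 by (intro power_increasing) auto
        then show ?thesis
          using a v1 unfolding abs_mult by (intro mult_mono) (auto simp: generators_def)
      qed
      finally have "\<bar>a i\<bar> \<le> K" by (simp add: K_def)
      moreover obtain m where m: "a i = of_int m"
        using a unfolding generators_def by (auto elim!: Ints_cases)
      ultimately have "m \<in> {- \<lceil>K\<rceil>..\<lceil>K\<rceil>}" by simp linarith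
      then show ?thesis using m by blast
    qed
    then show ?thesis by (auto simp: X_def)
  qed
  then have "(\<lambda>a. restrict a {..<D}) ` generators \<subseteq> X" by blast
  moreover have "finite X" unfolding X_def by (intro finite_PiE) auto
  moreover have "inj_on (\<lambda>a. restrict a {..<D}) generators"
  proof (rule inj_onI)
    fix a b assume "a \<in> generators" "b \<in> generators" and r: "restrict a {..<D} = restrict b {..<D}"
    moreover have "a i = b i" if "i < D" for i using fun_cong[OF r, of i] that by simp
    ultimately show "a = b" by (intro recseq_eqI) (auto simp: generators_def)
  qed
  ultimately show ?thesis by (meson finite_imageD finite_subset)
qed

text \<open>Rounding the multiples \<open>j * a / k\<close> to integer sequences, consecutive differences are
  close to \<open>a / k\<close>, and they add up to \<open>a\<close>.\<close>
lemma decompose: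
  assumes a: "recseq a" "\<And>n. a n \<in> \<int>" "dev a \<le> lead a / 2" "lead a \<ge> 4 * B"
  shows "\<exists>w. w \<noteq> [] \<and> set w \<subseteq> generators \<and> (\<Sum>e\<leftarrow>w. lead e) = lead a"
proof -
  \<comment> \<open>This puts \<open>q = lead a / k\<close> between \<open>4 * B\<close> and
    \<open>8 * B\<close>. From \<open>q \<ge> 4 * B\<close> follows
    \<open>q / 2 + B \<le> q - B\<close>, so a piece stays in the cone despite rounding.\<close>
  define k where "k = nat \<lfloor>lead a / (4 * B)\<rfloor>"
  have "lead a / (4 * B) \<ge> 1" using a(4) B_ge_1 by simp
  then have k1: "k \<ge> 1" "real k \<le> lead a / (4 * B)" "lead a / (4 * B) < real k + 1"
    unfolding k_def by linarith+
  have lower: "real k * (4 * B) \<le> lead a" and upper: "lead a < (real k + 1) * (4 * B)"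
    using k1(2,3) B_ge_1 by (simp_all add: field_simps)
  have "(real k + 1) * (4 * B) \<le> real k * (8 * B)"
    using mult_right_mono[of 1 "real k" B] k1(1) B_ge_1 by (simp add: algebra_simps)
  then have "lead a \<le> real k * (8 * B)" using upper by linarith
  define q where "q = lead a / real k"
  have lk: "q \<ge> 4 * B" "q \<le> 8 * B"
    using lower \<open>lead a \<le> real k * (8 * B)\<close> k1(1)
    by (simp_all add: q_def pos_le_divide_eq pos_divide_le_eq mult_ac)
  define c where "c j = extend (\<lambda>i. of_int \<lfloor>real j * a i / real k\<rfloor>)" for j :: nat
  define e where "e j = (\<lambda>n. c (Suc j) n - c j n)" for j
  have ce: "e j \<in> generators" for j
  proof -
    \<comment> \<open>The rounding error of one piece; initially a difference of two fractional
      parts, hence at most 1 in absolute value.\<close>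
    define \<eta> where "\<eta> = (\<lambda>n. e j n - 1 / real k * a n)"
    have rc: "recseq (c j)" for j by (simp add: c_def recseq_extend)
    have re: "recseq (e j)" unfolding e_def by (intro recseq_diff rc)
    have "\<bar>\<eta> i\<bar> \<le> 1" if i: "i < D" for i
    proof -
      have "real (Suc j) * a i / real k = real j * a i / real k + 1 / real k * a i"
        by (simp add: add_divide_distrib algebra_simps)
      then show ?thesis
        unfolding \<eta>_def e_def c_def extend_less[OF i] by linarith
    qed
    then have \<eta>: "\<bar>lead \<eta>\<bar> \<le> B" "dev \<eta> \<le> B" using lead_le_B dev_le_B by auto
    have e: "e j = (\<lambda>n. 1 / real k * a n + \<eta> n)" by (simp add: \<eta>_def)
    have l: "lead (e j) = q + lead \<eta>"
      unfolding e lead_add lead_scale by (simp add: q_def)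
    have "dev (e j) \<le> \<bar>1 / real k\<bar> * dev a + dev \<eta>"
      unfolding e using dev_add dev_scale by metis
    also have "\<dots> \<le> \<bar>1 / real k\<bar> * (lead a / 2) + B"
      using a(3) \<eta> by (intro add_mono mult_left_mono) auto
    also have "\<dots> = q / 2 + B" by (simp add: q_def)
    also have "\<dots> \<le> lead (e j)" using l \<eta> lk by linarith
    finally have "dev (e j) \<le> lead (e j)" .
    moreover have bnd: "1 \<le> lead (e j)" "lead (e j) \<le> 9 * B"
      using l \<eta> lk B_ge_1 by linarith+
    moreover have "e j n \<in> \<int>" for n
      unfolding e_def c_def by (intro Ints_diff extend_Ints) auto
    ultimately show ?thesis
      using re bnd by (simp add: generators_def)
  qed
  define w where "w = map e [0..<k]"
  have "(\<Sum>x\<leftarrow>map e [0..<m]. lead x) = lead (c m) - lead (c 0)" for m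
    by (induction m) (simp_all add: e_def lead_diff)
  moreover have "lead (c k) = lead a"
  proof (rule lead_cong)
    fix i assume "i < D"
    moreover have "of_int \<lfloor>a i\<rfloor> = a i" using a(2)[of i] by (auto elim: Ints_cases)
    ultimately show "c k i = a i" using k1 by (simp add: c_def extend_less)
  qed
  moreover have "lead (c 0) = 0"
  proof -
    have "lead (c 0) = lead (\<lambda>n. 0 * a n)" by (rule lead_cong) (simp add: c_def extend_less)
    then show ?thesis unfolding lead_scale by simp
  qed
  ultimately show ?thesis
    using k1 ce by (intro exI[of _ w]) (auto simp: w_def)
qed

lemma eventually_decomposable:
  assumes "recseq a" "lead a > 0"
  shows "eventually (\<lambda>n. dev (\<lambda>i. a (i + n)) \<le> lead (\<lambda>i. a (i + n)) / 2 \<and>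
     lead (\<lambda>i. a (i + n)) \<ge> 4 * B) sequentially"
proof -
  have "eventually (\<lambda>n. dev (\<lambda>i. a (i + n)) / v ^ n < lead a / 2) sequentially"
    by (rule order_tendstoD(2)[OF dev_shift_tendsto[OF assms(1)]]) (use assms(2) in simp)
  moreover have "eventually (\<lambda>n. v ^ n \<ge> 4 * B / lead a) sequentially"
    by (rule eventually_power_ge[OF v1])
  ultimately show ?thesis
  proof eventually_elim
    case (elim n)
    have "v ^ n > 0" using v1 by simp
    then show ?case using elim assms(2) by (simp add: lead_shift[OF assms(1)] field_simps)
  qed
qed

text \<open>Let only the last of the \<open>D\<close> initial values be nonzero: \<open>lead\<close>
  then sees just the leading coefficient of \<open>s\<close>, and the sign \<open>\<sigma>\<close>
  makes the result positive.\<close>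

lemma integral_seq_exists: "\<exists>a. recseq a \<and> (\<forall>n. a n \<in> \<int>) \<and> lead a > 0"
proof -
  define \<sigma> where "\<sigma> = sgn (lead_coeff s / poly s v)"
  define a where "a = extend (\<lambda>i. if i = degree s then \<sigma> else 0)"
  have "shift_poly s a 0 = (\<Sum>i<D. coeff s i * (if i = degree s then \<sigma> else 0))"
    unfolding shift_poly_s by (intro sum.cong refl) (simp add: a_def extend_less)
  also have "\<dots> = lead_coeff s * \<sigma>"
    unfolding degree_s by (simp add: if_distrib sum.delta cong: if_cong)
  finally have "lead a = (lead_coeff s / poly s v) * \<sigma>" by (simp add: lead_def)
  also have "\<dots> = \<bar>lead_coeff s / poly s v\<bar>" unfolding \<sigma>_def by (metis abs_sgn)
  also have "\<dots> > 0" using s_nz poly_s_v by simp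
  finally have "lead a > 0" .
  moreover have "a n \<in> \<int>" for n
    unfolding a_def by (rule extend_Ints) (auto simp: \<sigma>_def sgn_if)
  ultimately show ?thesis using recseq_extend a_def by blast
qed

text \<open>This is all that the words require of the recurrence. The words of weight
  \<open>c * v ^ r\<close> decompose shifts of one sequence; those completing \<open>z\<close> to
  weight \<open>v ^ N * lead e\<close> decompose the shifted \<open>e\<close> minus
  \<open>z\<close>. As \<open>generators\<close> is finite, one \<open>N\<close> serves all
  letters.\<close>

lemma perron_system:
  "\<exists>E z N c. finite E \<and> z \<in> E \<and> N \<ge> (1::nat) \<and> c > 0 \<and> (\<forall>e\<in>E. lead e > 0) \<and>
     (\<forall>e\<in>E. \<exists>w. set w \<subseteq> E \<and> lead z + (\<Sum>x\<leftarrow>w. lead x) = v ^ N * lead e) \<and>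
     (\<forall>r::nat. \<exists>w. w \<noteq> [] \<and> set w \<subseteq> E \<and> (\<Sum>x\<leftarrow>w. lead x) = c * v ^ r)"
proof -
  obtain a where a: "recseq a" "\<And>n. a n \<in> \<int>" "lead a > 0" using integral_seq_exists by blast
  obtain n0 where n0: "\<And>n. n \<ge> n0 \<Longrightarrow> dev (\<lambda>i. a (i + n)) \<le> lead (\<lambda>i. a (i + n)) / 2 \<and>
     lead (\<lambda>i. a (i + n)) \<ge> 4 * B"
    using eventually_decomposable[OF a(1,3)] by (auto simp: eventually_sequentially)
  \<comment> \<open>Starting the shifts at \<open>n0\<close> makes every exponent \<open>r\<close>
    admissible.\<close>
  define c where "c = v ^ n0 * lead a"
  have words: "\<exists>w. w \<noteq> [] \<and> set w \<subseteq> generators \<and> (\<Sum>x\<leftarrow>w. lead x) = c * v ^ r" for r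
    using decompose[of "\<lambda>i. a (i + (n0 + r))"] n0[of "n0 + r"] a(1,2) recseq_shift[OF a(1)]
      lead_shift[OF a(1), of "n0 + r"]
    by (simp add: c_def power_add mult_ac)
  obtain z where z: "z \<in> generators" using words[of 0] by (metis last_in_set subsetD)
  have pos: "lead e > 0" if "e \<in> generators" for e using that by (simp add: generators_def)
  have "eventually (\<lambda>N. \<exists>w. set w \<subseteq> generators \<and> lead z + (\<Sum>x\<leftarrow>w. lead x) = v ^ N * lead e) sequentially"
    if e: "e \<in> generators" for e
  proof -
    have re: "recseq e" and rz: "recseq z" using e z by (auto simp: generators_def)
    have "eventually (\<lambda>n. dev (\<lambda>i. e (i + n)) / v ^ n < 1 / 4) sequentially"
      by (rule order_tendstoD(2)[OF dev_shift_tendsto[OF re]]) simp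
    \<comment> \<open>With \<open>lead z\<close> and \<open>dev z\<close> at most
      \<open>9 * B\<close> and \<open>lead e \<ge> 1\<close>, it suffices that v^N / 4 + 9 B \<le>
      (v^N - 9 B) / 2, which amounts to v^N \<ge> 54 B.\<close>
    moreover have "eventually (\<lambda>n. v ^ n \<ge> 54 * B) sequentially"
      by (rule eventually_power_ge[OF v1])
    ultimately show ?thesis
    proof eventually_elim
      case (elim N)
      define g where "g = (\<lambda>i. e (i + N) - z i)"
      have vN: "v ^ N > 0" using v1 by simp
      have lg: "lead g = v ^ N * lead e - lead z"
        unfolding g_def lead_diff lead_shift[OF re] ..
      have "v ^ N * lead e \<ge> v ^ N * 1"
        using e vN by (intro mult_left_mono) (auto simp: generators_def)
      moreover have "lead z \<le> 9 * B" "dev z \<le> 9 * B" using z by (auto simp: generators_def)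
      moreover have "dev g \<le> dev (\<lambda>i. e (i + N)) + dev z" unfolding g_def by (rule dev_diff)
      moreover have "dev (\<lambda>i. e (i + N)) \<le> v ^ N / 4" using elim(1) vN by (simp add: field_simps)
      ultimately have "dev g \<le> lead g / 2" "lead g \<ge> 4 * B"
        using lg elim(2) B_ge_1 by linarith+
      moreover have "recseq g" unfolding g_def by (intro recseq_diff recseq_shift re rz)
      moreover have "g n \<in> \<int>" for n
        unfolding g_def using e z by (auto simp: generators_def)
      ultimately obtain w where "set w \<subseteq> generators" "(\<Sum>x\<leftarrow>w. lead x) = lead g"
        using decompose[of g] by blast
      then show ?case using lg by (intro exI[of _ w]) simp
    qed
  qed
  then have "eventually (\<lambda>N. \<forall>e\<in>generators. \<exists>w. set w \<subseteq> generators \<and>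
      lead z + (\<Sum>x\<leftarrow>w. lead x) = v ^ N * lead e) sequentially"
    by (intro eventually_ball_finite finite_generators) blast
  then have "eventually (\<lambda>N. (\<forall>e\<in>generators. \<exists>w. set w \<subseteq> generators \<and>
      lead z + (\<Sum>x\<leftarrow>w. lead x) = v ^ N * lead e) \<and> N \<ge> 1) sequentially"
    using eventually_ge_at_top by (rule eventually_conj)
  then obtain N where N: "N \<ge> 1" "\<forall>e\<in>generators. \<exists>w. set w \<subseteq> generators \<and>
      lead z + (\<Sum>x\<leftarrow>w. lead x) = v ^ N * lead e"
    by (auto dest!: eventually_happens)
  have "c > 0" using v1 a(3) by (simp add: c_def)
  show ?thesis
  proof (intro exI conjI)
    show "finite generators" by (rule finite_generators)
    show "z \<in> generators" by (rule z)
    show "1 \<le> N" by (rule N(1))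
    show "0 < c" by (rule \<open>c > 0\<close>)
    show "\<forall>e\<in>generators. lead e > 0" using pos by simp
    show "\<forall>e\<in>generators. \<exists>w. set w \<subseteq> generators \<and> lead z + (\<Sum>x\<leftarrow>w. lead x) = v ^ N * lead e"
      by (rule N(2))
    show "\<forall>r. \<exists>w. w \<noteq> [] \<and> set w \<subseteq> generators \<and> (\<Sum>x\<leftarrow>w. lead x) = c * v ^ r"
      by (rule allI) (rule words)
  qed
qed

end

section \<open>Growth of morphisms\<close>

lemma length_morph_ext_funpow:
  "length ((morph_ext h ^^ n) w) = (\<Sum>x\<leftarrow>w. length ((morph_ext h ^^ n) [x]))"
proof (induction w)
  case Nil
  show ?case using morph_ext_funpow_concat[of n h "[]"] by simp
next
  case (Cons x w)
  then show ?case using morph_ext_funpow_append[of n h "[x]" w] by simp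
qed

lemma of_nat_sum_list: "of_nat (\<Sum>x\<leftarrow>w. f x) = (\<Sum>x\<leftarrow>w. of_nat (f x))"
  by (induction w) auto

lemma sum_list_ge_first:
  fixes f :: "'a \<Rightarrow> real" and y :: 'a
  assumes "\<And>x. x \<in> set w \<Longrightarrow> f x \<ge> 0"
  shows "f y \<le> (\<Sum>x\<leftarrow>y # w. f x)"
proof -
  have "(\<Sum>x\<leftarrow>w. f x) \<ge> 0" using assms by (intro sum_list_nonneg) auto
  then show ?thesis by simp
qed

text \<open>Relative to the weights, the lengths of the iterates are averaged in every step, and the
  common letter \<open>z\<close> makes their oscillation contract.\<close>
lemma morphism_growth:
  fixes h :: "nat \<Rightarrow> nat list" and wt :: "nat \<Rightarrow> real" and V :: real
  assumes fin: "finite E" and z: "z \<in> E" and V: "V \<ge> 1"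
    and pos: "\<And>e. e \<in> E \<Longrightarrow> wt e > 0"
    and h: "\<And>e. e \<in> E \<Longrightarrow> h e = z # g e" "\<And>e. e \<in> E \<Longrightarrow> set (g e) \<subseteq> E"
    and eigen: "\<And>e. e \<in> E \<Longrightarrow> (\<Sum>x\<leftarrow>h e. wt x) = V * wt e"
  shows "\<exists>G>0. \<forall>w. set w \<subseteq> E \<longrightarrow>
    (\<lambda>n. real (length ((morph_ext h ^^ n) w)) / V ^ n) \<longlonglongrightarrow> G * (\<Sum>x\<leftarrow>w. wt x)"
proof -
  define L where "L n e = real (length ((morph_ext h ^^ n) [e]))" for n e
  \<comment> \<open>Normalised length per weight: \<open>q (Suc n) e\<close> is the mean of
    \<open>q n x\<close> over the letters x of \<open>h e\<close>, with shares
    \<open>wt x / (V * wt e)\<close>.\<close>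
  define q where "q n e = L n e / (V ^ n * wt e)" for n e
  define lo where "lo n = Min (q n ` E)" for n
  define hi where "hi n = Max (q n ` E)" for n
  \<comment> \<open>A lower bound for the share of the leading letter \<open>z\<close> in each of
    these means.\<close>
  define \<delta> where "\<delta> = wt z / (V * Max (wt ` E))"
  have E: "E \<noteq> {}" using z by auto
  have lhE: "set (h e) \<subseteq> E" if "e \<in> E" for e using h[OF that] z by auto
  have Max_pos: "Max (wt ` E) > 0" using fin z pos[OF z] by (meson Max_ge finite_imageI image_eqI less_le_trans)
  have lo_le: "lo n \<le> q n e" and hi_ge: "q n e \<le> hi n" if "e \<in> E" for n e
    using fin that by (auto simp: lo_def hi_def)
  have lohi: "lo n \<le> hi n" for n using lo_le[OF z] hi_ge[OF z] order_trans by blast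
  have \<delta>: "\<delta> > 0" "\<delta> \<le> 1"
  proof -
    show "\<delta> > 0" using pos[OF z] Max_pos V by (simp add: \<delta>_def)
    have "wt z \<le> Max (wt ` E)" using fin z by simp
    also have "\<dots> \<le> V * Max (wt ` E)" using V Max_pos by simp
    finally show "\<delta> \<le> 1" using V Max_pos by (simp add: \<delta>_def)
  qed
  have L_Suc: "L (Suc n) e = (\<Sum>x\<leftarrow>h e. L n x)" for n e
  proof -
    have "(morph_ext h ^^ Suc n) [e] = (morph_ext h ^^ n) (h e)"
      by (simp add: funpow_Suc_right morph_ext_def del: funpow.simps)
    then have "L (Suc n) e = real (\<Sum>x\<leftarrow>h e. length ((morph_ext h ^^ n) [x]))"
      unfolding L_def using length_morph_ext_funpow[of n h "h e"] by simp
    also have "\<dots> = (\<Sum>x\<leftarrow>h e. L n x)" unfolding L_def by (simp add: of_nat_sum_list comp_def)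
    finally show ?thesis .
  qed
  have avg: "(\<Sum>x\<leftarrow>h e. wt x * (t - q n x)) = V * wt e * (t - q (Suc n) e)"
    if e: "e \<in> E" for e n t
  proof -
    have Vn: "V ^ n > 0" using V by simp
    have "(\<Sum>x\<leftarrow>w. wt x * (t - q n x)) = t * (\<Sum>x\<leftarrow>w. wt x) - (\<Sum>x\<leftarrow>w. L n x) / V ^ n"
      if "set w \<subseteq> E" for w
      using that
    proof (induction w)
      case (Cons x w)
      then have "wt x > 0" using pos by simp
      then have "wt x * (t - q n x) = t * wt x - L n x / V ^ n" using Vn by (simp add: q_def field_simps)
      then show ?case using Cons by (simp add: algebra_simps add_divide_distrib)
    qed simp
    then have "(\<Sum>x\<leftarrow>h e. wt x * (t - q n x)) = t * (V * wt e) - L (Suc n) e / V ^ n"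
      unfolding L_Suc eigen[OF e, symmetric] using lhE[OF e] by blast
    moreover have "V * wt e * q (Suc n) e = L (Suc n) e / V ^ n"
      using pos[OF e] Vn V by (simp add: q_def)
    ultimately show ?thesis by (simp add: algebra_simps)
  qed
  \<comment> \<open>For an upper bound \<open>t\<close>, all summands in \<open>avg\<close> are
    nonnegative; keeping only the leading \<open>z\<close> already gives the gain.\<close>
  have step: "s \<le> t - q (Suc n) e"
    if e: "e \<in> E" and s: "0 \<le> t - q n z" "s = \<delta> * (t - q n z)" "\<And>x. x \<in> E \<Longrightarrow> q n x \<le> t" for e n s t
  proof -
    have "wt z * (t - q n z) \<le> (\<Sum>x\<leftarrow>z # g e. wt x * (t - q n x))"
      by (rule sum_list_ge_first)
         (use h(2)[OF e] s(3) pos in \<open>auto intro!: mult_nonneg_nonneg simp: less_imp_le subset_iff\<close>)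
    then have 1: "wt z * (t - q n z) \<le> V * wt e * (t - q (Suc n) e)"
      using avg[OF e, of t n] by (simp only: h(1)[OF e])
    have Ve: "0 < V * wt e" using V pos[OF e] by simp
    have "\<delta> \<le> wt z / (V * wt e)"
      unfolding \<delta>_def using fin e Ve pos[OF e] pos[OF z] V by (intro divide_left_mono mult_left_mono mult_pos_pos Max_ge Max_pos) auto
    then have "s \<le> wt z / (V * wt e) * (t - q n z)" unfolding s(2) using s(1) by (rule mult_right_mono)
    also have "\<dots> \<le> t - q (Suc n) e" using 1 Ve by (simp add: pos_divide_le_eq mult_ac)
    finally show ?thesis .
  qed
  have step': "s \<le> q (Suc n) e - t"
    if e: "e \<in> E" and s: "0 \<le> q n z - t" "s = \<delta> * (q n z - t)" "\<And>x. x \<in> E \<Longrightarrow> t \<le> q n x" for e n s t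
  proof -
    have neg: "(\<Sum>x\<leftarrow>w. wt x * (q n x - t)) = - (\<Sum>x\<leftarrow>w. wt x * (t - q n x))" for w
      by (induction w) (auto simp: algebra_simps)
    have "wt z * (q n z - t) \<le> (\<Sum>x\<leftarrow>z # g e. wt x * (q n x - t))"
      by (rule sum_list_ge_first)
         (use h(2)[OF e] s(3) pos in \<open>auto intro!: mult_nonneg_nonneg simp: less_imp_le subset_iff\<close>)
    then have 1: "wt z * (q n z - t) \<le> V * wt e * (q (Suc n) e - t)"
      using avg[OF e, of t n] unfolding h(1)[OF e] neg by (simp add: algebra_simps)
    have Ve: "0 < V * wt e" using V pos[OF e] by simp
    have "\<delta> \<le> wt z / (V * wt e)"
      unfolding \<delta>_def using fin e Ve pos[OF e] pos[OF z] V by (intro divide_left_mono mult_left_mono mult_pos_pos Max_ge Max_pos) auto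
    then have "s \<le> wt z / (V * wt e) * (q n z - t)" unfolding s(2) using s(1) by (rule mult_right_mono)
    also have "\<dots> \<le> q (Suc n) e - t" using 1 Ve by (simp add: pos_divide_le_eq mult_ac)
    finally show ?thesis .
  qed
  have hi_step: "hi (Suc n) \<le> hi n - \<delta> * (hi n - q n z)" for n
  proof -
    have "q (Suc n) e \<le> hi n - \<delta> * (hi n - q n z)" if "e \<in> E" for e
      using step[OF that _ refl, of "hi n" n] hi_ge z by force
    then show ?thesis unfolding hi_def[of "Suc n"] using fin E by simp
  qed
  have lo_step: "lo n + \<delta> * (q n z - lo n) \<le> lo (Suc n)" for n
  proof -
    have "lo n + \<delta> * (q n z - lo n) \<le> q (Suc n) e" if "e \<in> E" for e
      using step'[OF that _ refl, of n "lo n"] lo_le z by force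
    then show ?thesis unfolding lo_def[of "Suc n"] using fin E by simp
  qed
  \<comment> \<open>Both extremes move towards the common value \<open>q n z\<close> by the fraction
    \<open>\<delta>\<close> of their distance from it.\<close>
  have osc: "hi n - lo n \<le> (1 - \<delta>) ^ n * (hi 0 - lo 0)" for n
  proof (induction n)
    case (Suc n)
    have "hi (Suc n) - lo (Suc n) \<le> (1 - \<delta>) * (hi n - lo n)"
      using hi_step[of n] lo_step[of n] by (simp add: algebra_simps)
    also have "\<dots> \<le> (1 - \<delta>) * ((1 - \<delta>) ^ n * (hi 0 - lo 0))"
      using Suc \<delta> by (intro mult_left_mono) auto
    finally show ?case by simp
  qed simp
  have "(\<lambda>n. (1 - \<delta>) ^ n * (hi 0 - lo 0)) \<longlonglongrightarrow> 0 * (hi 0 - lo 0)"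
    using \<delta> by (intro tendsto_mult LIMSEQ_realpow_zero tendsto_const) auto
  then have osc_bound: "(\<lambda>n. (1 - \<delta>) ^ n * (hi 0 - lo 0)) \<longlonglongrightarrow> 0" by simp
  have osc0: "(\<lambda>n. hi n - lo n) \<longlonglongrightarrow> 0"
  proof (rule tendsto_sandwich[OF _ _ tendsto_const osc_bound])
    show "eventually (\<lambda>n. 0 \<le> hi n - lo n) sequentially" using lohi by simp
    show "eventually (\<lambda>n. hi n - lo n \<le> (1 - \<delta>) ^ n * (hi 0 - lo 0)) sequentially"
      by (rule always_eventually) (use osc in blast)
  qed
  have lo_mono: "incseq lo"
  proof (rule incseq_SucI)
    fix n
    have "0 \<le> \<delta> * (q n z - lo n)" using \<delta> lo_le[OF z] by simp
    then show "lo n \<le> lo (Suc n)" using lo_step[of n] by linarith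
  qed
  have hi_mono: "decseq hi"
  proof (rule decseq_SucI)
    fix n
    have "0 \<le> \<delta> * (hi n - q n z)" using \<delta> hi_ge[OF z] by simp
    then show "hi (Suc n) \<le> hi n" using hi_step[of n] by linarith
  qed
  have "lo n \<le> hi 0" for n using lohi[of n] decseqD[OF hi_mono, of 0 n] by simp
  then obtain G where G: "lo \<longlonglongrightarrow> G" "\<And>n. lo n \<le> G" using incseq_convergent[OF lo_mono] by blast
  \<comment> \<open>Initially \<open>q 0 e = 1 / wt e\<close>; as \<open>lo\<close> increases, the
    limit is positive.\<close>
  have "lo 0 > 0"
    unfolding lo_def using fin E pos by (auto simp: q_def L_def)
  then have "G > 0" using G(2)[of 0] by simp
  have "(\<lambda>n. lo n + (hi n - lo n)) \<longlonglongrightarrow> G + 0" by (intro tendsto_add G osc0)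
  then have hiG: "hi \<longlonglongrightarrow> G" by simp
  have q_lim: "(\<lambda>n. q n e) \<longlonglongrightarrow> G" if "e \<in> E" for e
    by (rule tendsto_sandwich[OF _ _ G(1) hiG]) (auto simp: lo_le hi_ge that)
  have "(\<lambda>n. real (length ((morph_ext h ^^ n) w)) / V ^ n) \<longlonglongrightarrow> G * (\<Sum>x\<leftarrow>w. wt x)"
    if "set w \<subseteq> E" for w
    using that
  proof (induction w)
    case Nil
    have "(morph_ext h ^^ n) [] = []" for n by (induction n) (simp_all add: morph_ext_def)
    then show ?case by simp
  next
    case (Cons x w)
    have x: "x \<in> E" "wt x > 0" using Cons.prems pos by auto
    have "(\<lambda>n. q n x * wt x + real (length ((morph_ext h ^^ n) w)) / V ^ n)
        \<longlonglongrightarrow> G * wt x + G * (\<Sum>x\<leftarrow>w. wt x)"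
      using Cons by (intro tendsto_add tendsto_mult q_lim tendsto_const) auto
    moreover have "q n x * wt x + real (length ((morph_ext h ^^ n) w)) / V ^ n
        = real (length ((morph_ext h ^^ n) (x # w))) / V ^ n" for n
      using x V length_morph_ext_funpow[of n h w] length_morph_ext_funpow[of n h "x # w"]
      by (simp add: q_def L_def add_divide_distrib)
    ultimately show ?case by (simp add: distrib_left)
  qed
  then show ?thesis using \<open>G > 0\<close> by blast
qed

section \<open>Perron exponents\<close>

text \<open>From n in the interval between \<open>T j\<close> and \<open>T (Suc j)\<close>, the next
  one is relatively farthest when n lies just behind \<open>T j\<close>; the ratio there tends to
  \<open>v\<close>. Since v > 1, the gaps eventually exceed 1.\<close>

lemma (in binary_digits) sparse_expansion:
  fixes v :: real and T :: "nat \<Rightarrow> nat"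
  assumes v: "v > 1" and T0: "T 0 \<ge> 1" and T_less: "\<And>j. T j < T (Suc j)"
    and ratio: "(\<lambda>j. real (T (Suc j)) / real (T j)) \<longlonglongrightarrow> v"
    and one: "\<And>j. d (T j) = 1" and zero: "\<And>j n. T j < n \<Longrightarrow> n < T (Suc j) \<Longrightarrow> d n = 0"
  shows "\<exists>\<xi>. base_expansion b \<xi> d \<and> v_exp b \<xi> = ereal (v - 1)"
proof (rule expansion_criterion)
  have T_ge: "T j \<ge> Suc j" for j
  proof (induction j)
    case (Suc j)
    then show ?case using T_less[of j] by simp
  qed (use T0 in simp)
  have T_mono: "T i \<le> T j" if "i \<le> j" for i j
    using lift_Suc_mono_le[of T, OF less_imp_le[OF T_less] that] .
  have bracket: "\<exists>j\<ge>J. T j \<le> n \<and> n < T (Suc j)" if n: "n \<ge> T J" for n J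
  proof -
    define j where "j = (LEAST j. n < T (Suc j))"
    have "n < T (Suc n)" using T_ge[of "Suc n"] by simp
    then have 1: "n < T (Suc j)" unfolding j_def by (rule LeastI)
    have "J \<le> j"
    proof (rule ccontr)
      assume "\<not> J \<le> j"
      then have "T (Suc j) \<le> T J" by (intro T_mono) simp
      then show False using n 1 by simp
    qed
    moreover have "T j \<le> n"
    proof (cases "j = J")
      case False
      then obtain i where i: "j = Suc i" using \<open>J \<le> j\<close> by (cases j) auto
      then have "\<not> n < T (Suc i)" using not_less_Least[of i "\<lambda>j. n < T (Suc j)"] j_def by simp
      then show ?thesis using i by simp
    qed (use n in simp)
    ultimately show ?thesis using 1 by blast
  qed
  have pos: "real (T j) > 0" for j using T_ge[of j] by simp
  show "v \<ge> 1" using v by simp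
  show "\<forall>\<^sub>F n in sequentially. \<exists>s\<ge>n. real s \<le> (v + \<epsilon>) * real n \<and> d s = 1" if e: "\<epsilon> > 0" for \<epsilon> :: real
  proof -
    obtain J where J: "\<And>j. j \<ge> J \<Longrightarrow> real (T (Suc j)) / real (T j) < v + \<epsilon>"
      using order_tendstoD(2)[OF ratio, of "v + \<epsilon>"] e by (auto simp: eventually_sequentially)
    show ?thesis
    proof (rule eventually_sequentiallyI[of "T J"])
      fix n assume "T J \<le> n"
      then obtain j where j: "j \<ge> J" "T j \<le> n" "n < T (Suc j)" using bracket by blast
      have "real (T (Suc j)) \<le> (v + \<epsilon>) * real (T j)"
        using J[OF j(1)] pos[of j] by (simp add: pos_divide_less_eq)
      also have "\<dots> \<le> (v + \<epsilon>) * real n" using j(2) v e by (intro mult_left_mono) auto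
      finally show "\<exists>s\<ge>n. real s \<le> (v + \<epsilon>) * real n \<and> d s = 1"
        using j(3) one by (intro exI[of _ "T (Suc j)"]) auto
    qed
  qed
  show "\<exists>\<^sub>F n in sequentially. \<forall>s\<ge>n. real s \<le> (v - \<epsilon>) * real n \<longrightarrow> d s = 0" if e: "\<epsilon> > 0" for \<epsilon> :: real
  proof -
    have "\<exists>n\<ge>N. \<forall>s\<ge>n. real s \<le> (v - \<epsilon>) * real n \<longrightarrow> d s = 0" for N
    proof -
      obtain J where J: "\<And>j. j \<ge> J \<Longrightarrow> real (T (Suc j)) / real (T j) > v - \<epsilon> / 2"
        using order_tendstoD(1)[OF ratio, of "v - \<epsilon> / 2"] e by (auto simp: eventually_sequentially)
      \<comment> \<open>Makes \<open>\<epsilon> / 2 * T j\<close> exceed \<open>v\<close>, which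
        pays for starting at \<open>T j + 1\<close> instead of \<open>T j\<close>.\<close>
      obtain K :: nat where K: "real K > 2 * v / \<epsilon>" using reals_Archimedean2 by blast
      define j where "j = max J (max N K)"
      have Tj: "T j \<ge> N" "T j \<ge> K" using T_ge[of j] by (auto simp: j_def)
      have "d s = 0" if s: "s \<ge> T j + 1" "real s \<le> (v - \<epsilon>) * real (T j + 1)" for s
      proof (rule zero)
        have "v - \<epsilon> / 2 < real (T (Suc j)) / real (T j)" by (rule J) (simp add: j_def)
        then have 1: "(v - \<epsilon> / 2) * real (T j) < real (T (Suc j))"
          using pos[of j] by (simp add: pos_less_divide_eq)
        have "real (T j) > 2 * v / \<epsilon>" using K Tj(2) by simp
        then have "\<epsilon> / 2 * real (T j) > v" using e by (simp add: field_simps)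
        then have "(v - \<epsilon>) * real (T j + 1) < (v - \<epsilon> / 2) * real (T j)"
          using e by (simp add: algebra_simps)
        then show "s < T (Suc j)" using s(2) 1 by linarith
      qed (use s in simp)
      then show ?thesis using Tj by (intro exI[of _ "T j + 1"]) auto
    qed
    then show ?thesis by (auto simp: frequently_sequentially)
  qed
  show "\<forall>\<^sub>F n in sequentially. d n = 0 \<or> d (Suc n) = 0"
  proof -
    \<comment> \<open>A ratio strictly between 1 and \<open>v\<close>; once
      \<open>(w - 1) * T j > 1\<close>, consecutive ones are at least two apart.\<close>
    define w where "w = (v + 1) / 2"
    have w: "w > 1" "w < v" using v by (auto simp: w_def)
    obtain J where J: "\<And>j. j \<ge> J \<Longrightarrow> real (T (Suc j)) / real (T j) > w"
      using order_tendstoD(1)[OF ratio w(2)] by (auto simp: eventually_sequentially)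
    obtain K :: nat where K: "real K > 1 / (w - 1)" using reals_Archimedean2 by blast
    show ?thesis
    proof (rule eventually_sequentiallyI[of "T (max J K)"])
      fix n assume "T (max J K) \<le> n"
      then obtain j where j: "j \<ge> max J K" "T j \<le> n" "n < T (Suc j)" using bracket by blast
      have "real (T j) > 1 / (w - 1)" using T_ge[of j] j(1) K by linarith
      then have "(w - 1) * real (T j) > 1" using w by (simp add: pos_divide_less_eq mult.commute)
      moreover have "w * real (T j) < real (T (Suc j))"
        using J[of j] j(1) pos[of j] by (simp add: pos_less_divide_eq)
      ultimately have "real (T (Suc j)) > real (T j) + 1" by (simp add: algebra_simps)
      then have "T (Suc j) > Suc (T j)" by linarith
      then show "d n = 0 \<or> d (Suc n) = 0"
        using zero[of j n] zero[of j "Suc n"] j by (cases "n = T j") auto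
    qed
  qed
qed

text \<open>Finitely many residue classes have a common threshold. This merges the limits of the
  block lengths, which \<open>morphism_growth\<close> gives for each class separately.\<close>

lemma tendsto_interleave:
  fixes a :: "nat \<Rightarrow> real"
  assumes N: "N \<ge> 1" and lim: "\<And>r. r < N \<Longrightarrow> (\<lambda>n. a (n * N + r)) \<longlonglongrightarrow> l"
  shows "a \<longlonglongrightarrow> l"
proof (rule LIMSEQ_I)
  fix e :: real assume e: "e > 0"
  have "\<forall>\<^sub>F n in sequentially. \<forall>r\<in>{..<N}. norm (a (n * N + r) - l) < e"
    using lim e by (intro eventually_ball_finite) (auto simp: LIMSEQ_iff eventually_sequentially)
  then obtain M where M: "\<And>n r. n \<ge> M \<Longrightarrow> r < N \<Longrightarrow> norm (a (n * N + r) - l) < e"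
    by (auto simp: eventually_sequentially)
  have "norm (a j - l) < e" if "j \<ge> M * N" for j
  proof -
    have "j div N \<ge> M" using div_le_mono[OF that, of N] N by simp
    then show ?thesis using M[of "j div N" "j mod N"] N by simp
  qed
  then show "\<exists>no. \<forall>n\<ge>no. norm (a n - l) < e" by blast
qed

text \<open>Divided by v^j, the sums satisfy a recurrence with factor 1 / v whose limiting fixed
  point is C / (v - 1); the deviation from it contracts.\<close>

lemma sum_geometric_asymptotics:
  fixes T B :: "nat \<Rightarrow> real"
  assumes v: "v > 1" and T: "\<And>j. T (Suc j) = T j + B j"
    and B: "(\<lambda>j. B j / v ^ j) \<longlonglongrightarrow> C" and C: "C > 0"
  shows "(\<lambda>j. T (Suc j) / T j) \<longlonglongrightarrow> v"
proof -
  have "(\<lambda>j. T j / v ^ j - C / (v - 1)) \<longlonglongrightarrow> 0"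
  proof (rule contracting_recurrence_tendsto_0)
    show "norm (1 / v) < 1" using v by simp
    have "(\<lambda>j. (B j / v ^ j - C) / v) \<longlonglongrightarrow> (C - C) / v"
      by (intro tendsto_divide tendsto_diff B tendsto_const) (use v in simp)
    then show "(\<lambda>j. (B j / v ^ j - C) / v) \<longlonglongrightarrow> 0" by simp
    fix j
    have "C / (v - 1) = 1 / v * (C / (v - 1)) + C / v" using v by (simp add: field_simps)
    moreover have "T (Suc j) / v ^ Suc j = 1 / v * (T j / v ^ j) + B j / v ^ j / v"
      by (simp add: T add_divide_distrib mult.commute)
    ultimately show "T (Suc j) / v ^ Suc j - C / (v - 1)
        = 1 / v * (T j / v ^ j - C / (v - 1)) + (B j / v ^ j - C) / v"
      unfolding right_diff_distrib diff_divide_distrib by linarith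
  qed
  then have lim: "(\<lambda>j. T j / v ^ j) \<longlonglongrightarrow> C / (v - 1)" by (simp add: LIM_zero_iff)
  have "(\<lambda>j. v * (T (Suc j) / v ^ Suc j) / (T j / v ^ j)) \<longlonglongrightarrow> v * (C / (v - 1)) / (C / (v - 1))"
    by (intro tendsto_divide tendsto_mult tendsto_const lim LIMSEQ_Suc[OF lim]) (use v C in simp)
  moreover have "v * (T (Suc j) / v ^ Suc j) / (T j / v ^ j) = T (Suc j) / T j" for j
    using v by simp
  ultimately show ?thesis using v C by simp
qed

lemma map_upt_add: "map f [m..<m + n] = map (\<lambda>r. f (m + r)) [0..<n]"
  by (rule nth_equalityI) auto

text \<open>Every block \<open>B j\<close> of the infinite word \<open>0 B\<^sub>0 B\<^sub>1 \<dots>\<close> carries a single marked letter, at its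
  start; \<open>B (n * N + r)\<close> is the \<open>n\<close>-th iterate of the \<open>r\<close>-th word, whose
  weight is \<open>c * v ^ r\<close>.\<close>
lemma morphic_exponent:
  fixes b N :: nat and v c :: real and wt :: "nat \<Rightarrow> real"
  assumes b: "b \<ge> 2" and v: "v > 1" and N: "N \<ge> 1" and c: "c > 0"
    and E: "finite E" "z \<in> E" and wt: "\<And>e. e \<in> E \<Longrightarrow> wt e > 0"
    and g: "\<And>e. e \<in> E \<Longrightarrow> set (g e) \<subseteq> E" "\<And>e. e \<in> E \<Longrightarrow> wt z + (\<Sum>x\<leftarrow>g e. wt x) = v ^ N * wt e"
    and xs: "\<And>r. xs r \<noteq> []" "\<And>r. set (xs r) \<subseteq> E" "\<And>r. (\<Sum>x\<leftarrow>xs r. wt x) = c * v ^ r"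
  shows "\<exists>\<xi> d. base_expansion b \<xi> d \<and> morphic d \<and> v_exp b \<xi> = ereal (v - 1)"
proof -
  define h where "h e = z # g e" for e
  obtain G where G: "G > 0" "\<And>w. set w \<subseteq> E \<Longrightarrow>
      (\<lambda>n. real (length ((morph_ext h ^^ n) w)) / (v ^ N) ^ n) \<longlonglongrightarrow> G * (\<Sum>x\<leftarrow>w. wt x)"
    using morphism_growth[OF E, of "v ^ N" wt h g] wt g v by (auto simp: h_def)
  \<comment> \<open>Every letter gets an unmarked odd copy and a marked positive even copy; 0
    remains free as the starting letter.\<close>
  define un mk :: "nat \<Rightarrow> nat" where "un e = 2 * e + 1" and "mk e = 2 * e + 2" for e
  define blk where "blk r = mk (hd (xs r)) # map un (tl (xs r))" for r
  define X where "X = concat (map blk [0..<N])"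
  \<comment> \<open>A marked letter passes its mark to the first letter of its image only, so
    iterates of a block keep exactly one mark, in front.\<close>
  define H where "H a = (if a = 0 then 0 # X
    else if odd a then map un (h ((a - 1) div 2))
    else mk z # map un (g ((a - 1) div 2)))" for a
  have H: "H 0 = 0 # X" "H (un e) = map un (h e)" "H (mk e) = mk z # map un (g e)" for e
    by (auto simp: H_def un_def mk_def)
  have HN_un: "(morph_ext H ^^ n) (map un w) = map un ((morph_ext h ^^ n) w)" for n w
  proof (induction n)
    case (Suc n)
    have "morph_ext H (map un u) = map un (morph_ext h u)" for u
      by (induction u) (simp_all add: morph_ext_def H)
    then show ?case using Suc by simp
  qed simp
  have HN_mk: "\<exists>e' w'. (morph_ext H ^^ n) (mk e # map un w) = mk e' # map un w' \<and>
      (morph_ext h ^^ n) (e # w) = e' # w'" for n e w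
  proof (induction n)
    case (Suc n)
    then obtain e' w' where IH: "(morph_ext H ^^ n) (mk e # map un w) = mk e' # map un w'"
      "(morph_ext h ^^ n) (e # w) = e' # w'" by blast
    have "morph_ext H (mk e' # map un w') = mk z # map un (g e' @ morph_ext h w')"
      using HN_un[of 1 w'] by (simp add: morph_ext_def H)
    moreover have "morph_ext h (e' # w') = z # g e' @ morph_ext h w'"
      by (simp add: morph_ext_def h_def)
    ultimately show ?case using IH by (metis comp_apply funpow.simps(2))
  qed auto
  define Bk where "Bk j = (morph_ext H ^^ (j div N)) (blk (j mod N))" for j
  have blk: "\<exists>e' w'. (morph_ext H ^^ n) (blk r) = mk e' # map un w' \<and>
      (morph_ext h ^^ n) (xs r) = e' # w'" for n r
    using HN_mk[of n "hd (xs r)" "tl (xs r)"] xs(1) by (simp add: blk_def)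
  have Bk: "\<exists>e' w'. Bk j = mk e' # map un w'" for j using blk unfolding Bk_def by blast
  have Bk_len: "length (Bk j) = length ((morph_ext h ^^ (j div N)) (xs (j mod N)))" for j
  proof -
    obtain e' w' where "Bk j = mk e' # map un w'" "(morph_ext h ^^ (j div N)) (xs (j mod N)) = e' # w'"
      using blk unfolding Bk_def by blast
    then show ?thesis by simp
  qed
  \<comment> \<open>Applying \<open>H\<close> raises the index of each block by \<open>N\<close>, so
    the iterates of \<open>X\<close> line up as consecutive groups of \<open>N\<close>
    blocks.\<close>
  have Bk_eq: "(morph_ext H ^^ n) X = concat (map Bk [n * N..<n * N + N])" for n
    unfolding X_def morph_ext_funpow_concat map_upt_add map_map
    by (intro arg_cong[of _ _ concat] map_cong refl) (simp add: Bk_def)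
  define W where "W k = 0 # concat (map Bk [0..<k])" for k
  have HN_0: "(morph_ext H ^^ n) [0] = W (n * N)" for n
  proof (induction n)
    case (Suc n)
    have "(morph_ext H ^^ Suc n) [0] = (morph_ext H ^^ n) ([0] @ X)"
      by (simp add: funpow_Suc_right morph_ext_def H del: funpow.simps)
    also have "\<dots> = W (n * N) @ concat (map Bk [n * N..<n * N + N])"
      by (simp only: morph_ext_funpow_append Suc Bk_eq)
    also have "\<dots> = W (Suc n * N)"
      using upt_add_eq_append[of 0 "n * N" N] by (simp add: W_def add.commute)
    finally show ?case .
  qed (simp add: W_def)
  define T where "T k = length (W k)" for k
  have W_Suc: "W (Suc k) = W k @ Bk k" for k by (simp add: W_def)
  have T_Suc: "T (Suc k) = T k + length (Bk k)" for k by (simp add: T_def W_Suc)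
  have Bk_pos: "length (Bk k) \<ge> 1" for k using Bk[of k] by auto
  have T_less: "T k < T (Suc k)" for k using T_Suc[of k] Bk_pos[of k] by linarith
  have T_0: "T 0 = 1" by (simp add: T_def W_def)
  have T_ge: "T k \<ge> Suc k" for k
  proof (induction k)
    case (Suc k)
    then show ?case using T_less[of k] by simp
  qed (simp add: T_0)
  \<comment> \<open>Position \<open>i\<close> exists in \<open>W i\<close> because
    \<open>T i > i\<close>, and the nested prefixes agree on it.\<close>
  define u where "u i = W i ! i" for i
  have W_pre: "\<exists>y. W (k + m) = W k @ y" for k m
  proof (induction m)
    case (Suc m)
    then show ?case by (auto simp: W_Suc)
  qed simp
  have W_nth: "W k ! i = u i" if i: "i < T k" for k i
  proof -
    have ii: "i < T i" using T_ge[of i] by simp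
    obtain y where y: "W (k + i) = W k @ y" using W_pre by blast
    obtain y' where y': "W (i + k) = W i @ y'" using W_pre by blast
    have "W k ! i = W (k + i) ! i" using i y by (simp add: nth_append T_def)
    also have "\<dots> = W i ! i" using ii y' by (simp add: nth_append T_def add.commute)
    finally show ?thesis by (simp add: u_def)
  qed
  have u_T: "u (T j + i) = Bk j ! i" if "i < length (Bk j)" for i j
    using W_nth[of "T j + i" "Suc j"] that by (simp add: T_Suc W_Suc nth_append T_def)
  define \<tau> where "\<tau> a = (if a > 0 \<and> even a then 1 else 0 :: nat)" for a :: nat
  define d where "d = \<tau> \<circ> u"
  define \<Sigma> where "\<Sigma> = {0} \<union> un ` E \<union> mk ` E"
  have setX: "set X \<subseteq> \<Sigma>"
  proof -
    have "set (blk r) \<subseteq> \<Sigma>" for r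
      using xs(1)[of r] xs(2)[of r] by (cases "xs r") (auto simp: blk_def \<Sigma>_def)
    then show ?thesis by (auto simp: X_def)
  qed
  have mor: "is_morphism \<Sigma> H"
    unfolding is_morphism_def
  proof
    fix a assume "a \<in> \<Sigma>"
    then consider "a = 0" | e where "e \<in> E" "a = un e" | e where "e \<in> E" "a = mk e"
      unfolding \<Sigma>_def by blast
    then show "set (H a) \<subseteq> \<Sigma>"
    proof cases
      case 1
      then show ?thesis using setX by (simp add: H \<Sigma>_def)
    next
      case (2 e)
      then show ?thesis using g(1)[of e] E(2) by (auto simp: H h_def \<Sigma>_def)
    next
      case (3 e)
      then show ?thesis using g(1)[of e] E(2) by (auto simp: H \<Sigma>_def)
    qed
  qed
  have X_ne: "(morph_ext H ^^ n) X \<noteq> []" for n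
  proof -
    have "Bk (n * N) \<noteq> []" using Bk[of "n * N"] by auto
    moreover have "n * N \<in> set [n * N..<n * N + N]" using N by simp
    ultimately show ?thesis unfolding Bk_eq concat_eq_Nil_conv set_map by blast
  qed
  have prol: "prolongable \<Sigma> H 0"
    unfolding prolongable_def using setX X_ne X_ne[of 0] by (auto simp: H \<Sigma>_def)
  have "is_fixed_word H 0 u"
    unfolding is_fixed_word_def HN_0 using W_nth by (simp add: T_def)
  moreover have "finite \<Sigma>" using E(1) by (simp add: \<Sigma>_def)
  ultimately have "morphic d"
    unfolding morphic_def d_def using mor prol by blast
  have d_T: "d (T j) = 1" for j
  proof -
    obtain e' w' where "Bk j = mk e' # map un w'" using Bk by blast
    then show ?thesis using u_T[of 0 j] by (simp add: d_def \<tau>_def mk_def)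
  qed
  have d_0: "d n = 0" if n: "T j < n" "n < T (Suc j)" for n j
  proof -
    obtain e' w' where B: "Bk j = mk e' # map un w'" using Bk by blast
    define i where "i = n - T j - 1"
    have ni: "n = T j + Suc i" using n(1) by (simp add: i_def)
    then have i: "Suc i < length (Bk j)" using n(2) by (simp add: T_Suc)
    then have "u n = un (w' ! i)" using u_T[OF i] B by (simp add: ni)
    then show ?thesis by (simp add: d_def \<tau>_def un_def)
  qed
  \<comment> \<open>For j = n * N + r the length behaves like G * (c * v^r) * v^(N n) = G c v^j,
    with the same constant in every residue class.\<close>
  have lenlim: "(\<lambda>j. real (length (Bk j)) / v ^ j) \<longlonglongrightarrow> G * c"
  proof (rule tendsto_interleave[OF N])
    fix r assume r: "r < N"
    have "(\<lambda>n. real (length ((morph_ext h ^^ n) (xs r))) / (v ^ N) ^ n / v ^ r)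
        \<longlonglongrightarrow> G * (\<Sum>x\<leftarrow>xs r. wt x) / v ^ r"
      by (intro tendsto_divide G(2) xs(2) tendsto_const) (use v in simp)
    moreover have "G * (\<Sum>x\<leftarrow>xs r. wt x) / v ^ r = G * c" using v by (simp add: xs(3))
    moreover have "real (length ((morph_ext h ^^ n) (xs r))) / (v ^ N) ^ n / v ^ r
        = real (length (Bk (n * N + r))) / v ^ (n * N + r)" for n
      using r N by (simp add: Bk_len power_add power_mult[symmetric] mult.commute)
    ultimately show "(\<lambda>n. real (length (Bk (n * N + r))) / v ^ (n * N + r)) \<longlonglongrightarrow> G * c" by simp
  qed
  have ratio: "(\<lambda>j. real (T (Suc j)) / real (T j)) \<longlonglongrightarrow> v"
    by (rule sum_geometric_asymptotics[OF v _ lenlim]) (use G(1) c in \<open>simp_all add: T_Suc\<close>)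
  interpret binary_digits b d
    by unfold_locales (use b in \<open>auto simp: d_def \<tau>_def\<close>)
  have "\<exists>\<xi>. base_expansion b \<xi> d \<and> v_exp b \<xi> = ereal (v - 1)"
    by (rule sparse_expansion[OF v _ T_less ratio d_T d_0]) (simp_all add: T_0)
  then show ?thesis using \<open>morphic d\<close> by blast
qed

lemma perron_exponent:
  fixes b :: nat and v :: real
  assumes b: "b \<ge> 2" and v: "perron_number v" "v > 1"
  shows "\<exists>\<xi> d. base_expansion b \<xi> d \<and> morphic d \<and> v_exp b \<xi> = ereal (v - 1)"
proof -
  obtain p :: "int poly" where "perron_polynomial v p"
    using perron_integer_polynomial[OF v(1)] v(2) unfolding perron_polynomial_def by blast
  then interpret perron_polynomial v p .
  obtain E z and N :: nat and c where E: "finite E" "z \<in> E" and N: "N \<ge> 1" and c: "c > 0"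
    and pos: "\<forall>e\<in>E. lead e > 0"
    and g: "\<forall>e\<in>E. \<exists>w. set w \<subseteq> E \<and> lead z + (\<Sum>x\<leftarrow>w. lead x) = v ^ N * lead e"
    and xs: "\<forall>r. \<exists>w. w \<noteq> [] \<and> set w \<subseteq> E \<and> (\<Sum>x\<leftarrow>w. lead x) = c * v ^ r"
    using perron_system by blast
  obtain g' where g': "\<And>e. e \<in> E \<Longrightarrow> set (g' e) \<subseteq> E"
    "\<And>e. e \<in> E \<Longrightarrow> lead z + (\<Sum>x\<leftarrow>g' e. lead x) = v ^ N * lead e"
    using g by metis
  obtain xs' where xs': "\<And>r. xs' r \<noteq> []" "\<And>r. set (xs' r) \<subseteq> E"
    "\<And>r. (\<Sum>x\<leftarrow>xs' r. lead x) = c * v ^ r"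
    using xs by metis
  \<comment> \<open>The generators are sequences, whereas letters must be natural numbers;
    \<open>f\<close> numbers them.\<close>
  obtain f :: "(nat \<Rightarrow> real) \<Rightarrow> nat" where f: "inj_on f E"
    using finite_imp_inj_to_nat_seg[OF E(1)] by blast
  define f' where "f' = inv_into E f"
  have f': "f' (f e) = e" if "e \<in> E" for e using f that by (simp add: f'_def)
  have sum_f: "(\<Sum>x\<leftarrow>map f w. lead (f' x)) = (\<Sum>x\<leftarrow>w. lead x)" if "set w \<subseteq> E" for w
    using that by (induction w) (auto simp: f')
  show ?thesis
  proof (rule morphic_exponent[OF b v(2) N c, of "f ` E" "f z" "lead \<circ> f'" "\<lambda>e. map f (g' (f' e))" "\<lambda>r. map f (xs' r)"])
    show "finite (f ` E)" "f z \<in> f ` E" using E by auto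
    show "(lead \<circ> f') e > 0" if "e \<in> f ` E" for e using that pos by (auto simp: f')
    show "set (map f (g' (f' e))) \<subseteq> f ` E" if "e \<in> f ` E" for e
      using that g'(1) by (fastforce simp: f')
    show "(lead \<circ> f') (f z) + (\<Sum>x\<leftarrow>map f (g' (f' e)). (lead \<circ> f') x) = v ^ N * (lead \<circ> f') e"
      if e: "e \<in> f ` E" for e
    proof -
      obtain e0 where e0: "e0 \<in> E" "e = f e0" using e by blast
      then show ?thesis
        using sum_f[OF g'(1)[OF e0(1)]] g'(2)[OF e0(1)] E(2) by (simp add: f' comp_def)
    qed
    show "map f (xs' r) \<noteq> []" "set (map f (xs' r)) \<subseteq> f ` E" for r using xs'(1,2)[of r] by auto
    show "(\<Sum>x\<leftarrow>map f (xs' r). (lead \<circ> f') x) = c * v ^ r" for r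
      using sum_f[OF xs'(2)[of r]] xs'(3)[of r] by (simp add: comp_def)
  qed
qed

theorem theorem2:
  fixes b :: nat
  assumes "b \<ge> 2"
  shows "(\<forall>v::real. v \<in> \<rat> \<and> v \<ge> 1 \<longrightarrow>
            (\<exists>\<xi> d. base_expansion b \<xi> d \<and> automatic d \<and> v_exp b \<xi> = ereal (v - 1)))
       \<and> (\<forall>v::real. perron_number v \<and> v > 1 \<longrightarrow>
            (\<exists>\<xi> d. base_expansion b \<xi> d \<and> morphic d \<and> v_exp b \<xi> = ereal (v - 1)))"
  using rational_exponent[OF assms] perron_exponent[OF assms] by blast

end
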